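(* Let $n\geq 4$, let $I\subset\{0,1,\ldots,n\}$ with $0,n\notin I$, and let $\mathcal{X}=2^{n+1}_I$ be the premaniplex of rank $n+1$ with two vertices, which has links of colors $0$ and $n$. Let $\xi'$ be the voltage assignment on $\mathcal{X}$, with values in the permutations of $(\mathcal{M}_n)_w\times\mathbb{Z}_{2\ell}$, defined in the context. Then for every $k>1$ (with $k\leq n$), every $m\in[0,n]$, and all pairs of vertices $(a,b)$ of $\mathcal{X}$ (possibly equal), $$\xi'(\Pi^{a,b}_{[0,m]}(\mathcal{X}))\cap\xi'(\Pi^{a,b}_{[k,n]}(\mathcal{X}))=\xi'(\Pi^{a,b}_{[k,m]}(\mathcal{X})).$$
   Context: Premaniplexes. For $I\subsetneq\{0,\ldots,n\}$, $2^{n+1}_I$ is the graph with two vertices (one called white, the other black) having, for each color $i\in I$, a semi-edge of color $i$ at each vertex and, for each color $i\in\{0,\ldots,n\}\setminus I$, a link (edge with two distinct endpoints) of color $i$ joining the two vertices. A dart is an oriented edge; a link has two mutually inverse darts, a semi-edge has one dart, which is its own inverse. Paths are sequences of consecutive darts, considered up to homotopy (insertion/deletion of consecutive inverse darts). $[k,m]=\{k,k+1,\ldots,m\}$ (empty if $k>m$), and $\Pi^{a,b}_{J}(\mathcal{X})$ is the set of (homotopy classes of) paths from $a$ to $b$ using only darts with colors in $J$; the empty path at a vertex is allowed, so $\xi'(\Pi^{a,b}_\emptyset)$ is the trivial group if $a=b$ and empty if $a\neq b$. Maniplexes. An $n$-maniplex is a connected simple graph (vertices are called flags) with edges colored by $\{0,\ldots,n-1\}$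 such that each vertex is incident to exactly one edge of each color and, for $|i-j|>1$, alternating paths of length 4 in colors $i,j$ are closed. $\Phi^i$ is the $i$-neighbor of $\Phi$; $r_i$ is the permutation $\Phi\mapsto\Phi^i$; the $r_i$ generate the monodromy group. $i$-faces are the connected components after deleting color $i$, with facets being $(n-1)$-faces; faces are incident if they intersect, and $F\le G$ if they are incident and the rank of $F$ is at most that of $G$; formal least and greatest faces are added. Automorphisms are color-preserving graph automorphisms. Automorphisms and flag permutations act on the right. The family $\mathcal{M}_n$. For an $r$-maniplex $\mathcal{M}$ with facet set $\mathrm{Fac}(\mathcal{M})$, $\hat{2}^{\mathcal{M}}$ is the $(r+1)$-maniplex with flags $(\Phi,x)$, $\Phi$ a flag of $\mathcal{M}$ and $x\in\mathbb{Z}_2^{\mathrm{Fac}(\mathcal{M})}$, with $(\Phi,x)^i=(\Phi^i,x)$ for $i<r$ and $(\Phi,x)^r=(\Phi,x+\chi_{\mathrm{Fac}(\Phi)})$, where $\mathrm{Fac}(\Phi)$ is the facet of $\Phi$ and $\chi_F$ is the characteristic function of $F$. $\mathcal{M}_2$ is the flag-graph of a square and $\mathcal{M}_{j+1}=\hat{2}^{\mathcal{M}_j}$; each $\mathcal{M}_j$ is the flag-graph of a regular polytope. The support $\mathrm{supp}(x)$ is the set of facets $F$ with $x(F)=1$. The $i$-faces of $\mathcal{M}_n=\hat{2}^{\mathcal{M}_{n-1}}$ ($i\le n-1$) are the classes of pairs $(F,x)$, $F$ an $i$-face of $\mathcal{M}_{n-1}$, where $(F,x)\sim(F',x')$ iff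 $F=F'$ and every $G\in\mathrm{supp}(x+x')$ satisfies $F\le G$. If $f_{n-1}$ is the greatest face of $\mathcal{M}_{n-1}$, the facets of $\mathcal{M}_n$ are $(f_{n-1},x)$, consisting of the flags $(\psi,x)$ with $x$ fixed; the base facet is $(f_{n-1},0)$. The sets $S_j$. $S_3$ is a fixed set of facets of $\mathcal{M}_3$ (the map $\{4,4\}_{(4,0)}$, a $4\times4$ toroidal chessboard) that is not invariant under any non-trivial automorphism of $\mathcal{M}_3$ and that is not contained in the union of the sets of facets incident to $u$ and to $v$, for any two 0-faces $u,v$. For $j\geq4$, $S_j=\{(f_{j-1},\chi_F):F\in S_{j-1}\}\cup\{(f_{j-1},0)\}$, with $f_{j-1}$ the greatest face of $\mathcal{M}_{j-1}$. No $S_j$ is invariant under a non-trivial automorphism of $\mathcal{M}_j$. Base edges and $\widetilde{\rho}_0$ ($n\ge4$). Fix a base flag of $\mathcal{M}_{n-1}$ with 1-face $e$. The base edge of the facet $(f_{n-1},x)$ of $\mathcal{M}_n$ is $(e\gamma,x)$ if $\mathrm{supp}(x)=S_{n-1}\gamma$ for some (necessarily unique) automorphism $\gamma$ of $\mathcal{M}_{n-1}$, and $(e,x)$ otherwise. For each facet $F$ of $\mathcal{M}_n$ choose a flag $\Phi_F$ in $F$ whose 1-face is the base edge of $F$. $\widetilde{\rho}_0$ is the permutation of the flags of $\mathcal{M}_n$ that preserves each facet $F$ and acts on it as the automorphism of $F$ (preserving colors $0,\ldots,n-2$) sending $\Phi_F$ to $\Phi_F^0$; this does not depend on the choice of $\Phi_F$.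 White flags. Fix a covering $p$ from $\mathcal{M}_n$ to the graph obtained from $\mathcal{X}$ by deleting the edge of color $n$, i.e. a map on vertices preserving $i$-adjacencies for all $i\in\{0,\ldots,n-1\}$ (such a $p$ exists); a flag is white or black according to its image under $p$. $(\mathcal{M}_n)_w$ is the set of white flags. A flag permutation $\omega$ preserving the color of flags acts on $(\mathcal{M}_n)_w\times\mathbb{Z}_{2\ell}$ by $(\Psi,c)\omega=(\Psi\omega,c)$; here $\ell$ is a fixed (large) positive integer. The permutations $r_0r_i$ and $r_ir_0$ for $i\notin I$, $r_i$ and $r_0r_ir_0$ for $i\in I$, and $\widetilde{\rho}_0r_0$ preserve the color of flags. Let $s$ be an involution on $(\mathcal{M}_n)_w\times\mathbb{Z}_{2\ell}$ that acts only on the $\mathbb{Z}_{2\ell}$-coordinate and commutes with $\widetilde{\rho}_0r_0$, and let $\widetilde{y}_n=\widetilde{\rho}_0r_0s$, an involution. The voltage assignment $\xi'$ (with $r_i$ the generators of the monodromy group of $\mathcal{M}_n$): $\xi'(d)=1$ if $d$ has color 0; $\xi'(d)=\widetilde{y}_n$ if $d$ has color $n$; and for $d$ of color $i\in[1,n-1]$: $\xi'(d)=r_i$ if $d$ is a semi-edge at the white vertex, $\xi'(d)=r_0r_ir_0$ if $d$ is a semi-edge at the black vertex, $\xi'(d)=r_0r_i$ if $d$ goes from white to black, $\xi'(d)=r_ir_0$ if $d$ goes from black to white. It is extended to paths by $\xi'(d_1d_2\cdots d_q)=\xi'(d_q)\cdots\xi'(d_2)\xi'(d_1)$. *)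

theory Defs
  imports "HOL-Library.FSet" "HOL-Combinatorics.Permutations"
begin

text \<open>
  Automorphisms and flag permutations act on the right, so a product \<open>g h\<close> means "first \<open>g\<close>, then
  \<open>h\<close>"; it is written \<^term>\<open>fcomp g h\<close>, with the infix notation enabled here.  A permutation of a
  set \<open>A\<close> is a function with \<^term>\<open>g permutes A\<close>, i.e. it is the identity outside \<open>A\<close>.
\<close>

unbundle state_combinator_syntax

section \<open>Premaniplexes, paths and voltages\<close>

record ('v, 'd) premaniplex =
  verts :: "'v set"
  darts :: "'d set"
  src :: "'d \<Rightarrow> 'v"
  rev_dart :: "'d \<Rightarrow> 'd"
  col :: "'d \<Rightarrow> nat"

definition tgt :: "('v, 'd) premaniplex \<Rightarrow> 'd \<Rightarrow> 'v" where
  "tgt X d = src X (rev_dart X d)"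

definition delete_color :: "nat \<Rightarrow> ('v, 'd) premaniplex \<Rightarrow> ('v, 'd) premaniplex" where
  "delete_color i X = X\<lparr>darts := {d \<in> darts X. col X d \<noteq> i}\<rparr>"

fun walk :: "('v, 'd) premaniplex \<Rightarrow> 'v \<Rightarrow> 'v \<Rightarrow> 'd list \<Rightarrow> bool" where
  "walk X a b [] \<longleftrightarrow> a = b \<and> a \<in> verts X"
| "walk X a b (d # ds) \<longleftrightarrow> d \<in> darts X \<and> src X d = a \<and> walk X (tgt X d) b ds"

definition elem_homotopy :: "('v, 'd) premaniplex \<Rightarrow> 'v \<Rightarrow> 'v \<Rightarrow> ('d list \<times> 'd list) set" where
  "elem_homotopy X a b =
     {(u @ v, u @ [d, rev_dart X d] @ v) | u v d.
        walk X a b (u @ v) \<and> walk X a b (u @ [d, rev_dart X d] @ v)}"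

definition homotopy :: "('v, 'd) premaniplex \<Rightarrow> 'v \<Rightarrow> 'v \<Rightarrow> ('d list \<times> 'd list) set" where
  "homotopy X a b = (elem_homotopy X a b \<union> (elem_homotopy X a b)\<inverse>)\<^sup>*"

text \<open>The set \<open>\<Pi>\<^sup>a\<^sup>b\<^sub>J(X)\<close>: homotopy classes (in \<open>X\<close>) that have a representative using only colors in \<open>J\<close>.\<close>

definition paths :: "('v, 'd) premaniplex \<Rightarrow> nat set \<Rightarrow> 'v \<Rightarrow> 'v \<Rightarrow> 'd list set set" where
  "paths X J a b =
     {homotopy X a b `` {w} | w. walk X a b w \<and> col X ` set w \<subseteq> J}"

fun walk_voltage :: "('d \<Rightarrow> 'g \<Rightarrow> 'g) \<Rightarrow> 'd list \<Rightarrow> 'g \<Rightarrow> 'g" where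
  "walk_voltage \<xi> [] = id"
| "walk_voltage \<xi> (d # ds) = walk_voltage \<xi> ds \<circ>> \<xi> d"

text \<open>
  The voltage of a homotopy class is the common value of its representatives: inverse darts have
  mutually inverse voltages for the assignment considered here.
\<close>

definition path_voltage :: "('d \<Rightarrow> 'g \<Rightarrow> 'g) \<Rightarrow> 'd list set \<Rightarrow> 'g \<Rightarrow> 'g" where
  "path_voltage \<xi> C = the_elem (walk_voltage \<xi> ` C)"

datatype vertex = White | Black

fun other :: "vertex \<Rightarrow> vertex" where
  "other White = Black"
| "other Black = White"

text \<open>
  The premaniplex \<open>2\<^sup>n\<^sup>+\<^sup>1\<^sub>I\<close>, of rank \<open>n + 1\<close>.  Every vertex is the start of exactly one dart of each
  color, so the dart of color \<open>i\<close> starting at \<open>v\<close> is encoded as \<open>(v, i)\<close>.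
\<close>

definition two_premaniplex :: "nat \<Rightarrow> nat set \<Rightarrow> (vertex, vertex \<times> nat) premaniplex" where
  "two_premaniplex n I =
     \<lparr>verts = UNIV,
      darts = UNIV \<times> {0..n},
      src = fst,
      rev_dart = (\<lambda>(v, i). (if i \<in> I then v else other v, i)),
      col = snd\<rparr>"

section \<open>Maniplexes: faces, automorphisms and coverings\<close>

record 'f maniplex =
  mrank :: nat
  flags :: "'f set"
  adj :: "nat \<Rightarrow> 'f \<Rightarrow> 'f"

definition component :: "'f maniplex \<Rightarrow> nat set \<Rightarrow> 'f \<Rightarrow> 'f set" where
  "component M J \<Phi> = {(\<Psi>, adj M i \<Psi>) | \<Psi> i. \<Psi> \<in> flags M \<and> i \<in> J}\<^sup>* `` {\<Phi>}"

text \<open>A face is the set of flags of a component; the greatest face of \<open>M\<close> is \<^term>\<open>flags M\<close>, of rank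
  \<^term>\<open>mrank M\<close>.\<close>

definition face_at :: "'f maniplex \<Rightarrow> nat \<Rightarrow> 'f \<Rightarrow> 'f set" where
  "face_at M i \<Phi> = component M ({..<mrank M} - {i}) \<Phi>"

definition faces :: "'f maniplex \<Rightarrow> nat \<Rightarrow> 'f set set" where
  "faces M i = face_at M i ` flags M"

definition facet_at :: "'f maniplex \<Rightarrow> 'f \<Rightarrow> 'f set" where
  "facet_at M \<Phi> = face_at M (mrank M - 1) \<Phi>"

definition facets :: "'f maniplex \<Rightarrow> 'f set set" where
  "facets M = faces M (mrank M - 1)"

definition incident :: "'f set \<Rightarrow> 'f set \<Rightarrow> bool" where
  "incident F G \<longleftrightarrow> F \<inter> G \<noteq> {}"

text \<open>The order on faces, each given together with its rank.\<close>

definition face_le :: "nat \<times> 'f set \<Rightarrow> nat \<times> 'f set \<Rightarrow> bool" where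
  "face_le = (\<lambda>(i, F) (j, G). incident F G \<and> i \<le> j)"

definition automorphism :: "'f maniplex \<Rightarrow> ('f \<Rightarrow> 'f) \<Rightarrow> bool" where
  "automorphism M \<gamma> \<longleftrightarrow>
     \<gamma> permutes flags M \<and> (\<forall>i<mrank M. \<forall>\<Phi>\<in>flags M. \<gamma> (adj M i \<Phi>) = adj M i (\<gamma> \<Phi>))"

text \<open>A facet as a maniplex in its own right, of rank one less.\<close>

definition facet_maniplex :: "'f maniplex \<Rightarrow> 'f set \<Rightarrow> 'f maniplex" where
  "facet_maniplex M F = M\<lparr>mrank := mrank M - 1, flags := F\<rparr>"

definition covering :: "'f maniplex \<Rightarrow> ('v, 'd) premaniplex \<Rightarrow> ('f \<Rightarrow> 'v) \<Rightarrow> bool" where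
  "covering M X p \<longleftrightarrow>
     (\<forall>\<Phi>\<in>flags M. p \<Phi> \<in> verts X \<and>
        (\<forall>i<mrank M. \<exists>d\<in>darts X. col X d = i \<and> src X d = p \<Phi> \<and> tgt X d = p (adj M i \<Phi>)))"

section \<open>The maniplexes \<open>M\<^sub>n\<close>\<close>

text \<open>
  One type contains the flags of all \<open>M\<^sub>n\<close>.  \<open>Sq v e\<close> is the flag of the square with vertex \<open>v\<close> and
  edge \<open>e\<close>, and \<open>Hat \<Phi> x\<close> is the flag \<open>(\<Phi>, x)\<close> of \<open>2\<^sup>M\<close>, where a vector \<open>x\<close> over the two-element
  field indexed by facets is given by its support, a finite set of facets (finite sets of flags).
\<close>

datatype flag = Sq nat nat | Hat flag "flag fset fset"

type_synonym vec = "flag fset fset"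

definition supp :: "vec \<Rightarrow> flag set set" where
  "supp x = fset ` fset x"

definition vec_add :: "vec \<Rightarrow> vec \<Rightarrow> vec" where
  "vec_add x y = (x - y) |\<union>| (y - x)"

text \<open>The characteristic function of a facet, and the zero vector.  All \<open>M\<^sub>n\<close> are finite, so
  \<^const>\<open>Abs_fset\<close> is only applied to finite sets.\<close>

definition chi :: "flag set \<Rightarrow> vec" where
  "chi F = {|Abs_fset F|}"

definition zero_vec :: vec where
  "zero_vec = {||}"

definition vecs :: "flag maniplex \<Rightarrow> vec set" where
  "vecs M = {x. supp x \<subseteq> facets M}"

text \<open>The square has vertices 0, 1, 2, 3, and its edge \<open>e\<close> joins \<open>e\<close> to \<open>e + 1\<close> modulo 4.\<close>

fun square_adj :: "nat \<Rightarrow> flag \<Rightarrow> flag" where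
  "square_adj i (Sq v e) =
     (if i = 0 then (if v = e then Sq ((e + 1) mod 4) e else Sq e e)
      else (if e = v then Sq v ((v + 3) mod 4) else Sq v v))"
| "square_adj i (Hat \<Phi> x) = Hat \<Phi> x"

definition square :: "flag maniplex" where
  "square =
     \<lparr>mrank = 2,
      flags = {Sq v e | v e. v < 4 \<and> e < 4 \<and> (v = e \<or> v = (e + 1) mod 4)},
      adj = square_adj\<rparr>"

fun hat_adj :: "flag maniplex \<Rightarrow> nat \<Rightarrow> flag \<Rightarrow> flag" where
  "hat_adj M i (Hat \<Phi> x) =
     (if i < mrank M then Hat (adj M i \<Phi>) x else Hat \<Phi> (vec_add x (chi (facet_at M \<Phi>))))"
| "hat_adj M i (Sq v e) = Sq v e"

definition hat :: "flag maniplex \<Rightarrow> flag maniplex" where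
  "hat M =
     \<lparr>mrank = mrank M + 1,
      flags = {Hat \<Phi> x | \<Phi> x. \<Phi> \<in> flags M \<and> x \<in> vecs M},
      adj = hat_adj M\<rparr>"

text \<open>The family starts at \<open>MM 2\<close>; for \<open>n < 2\<close>, \<open>MM n\<close> is a dummy value.\<close>

definition MM :: "nat \<Rightarrow> flag maniplex" where
  "MM n = (hat ^^ (n - 2)) square"

text \<open>
  The face \<open>(F, x)\<close> of \<open>hat M\<close>, where \<open>F\<close> is an \<open>i\<close>-face of \<open>M\<close> (possibly the greatest one): the
  class of \<open>(F, x)\<close>, as the set of flags \<open>(\<psi>, y)\<close> with \<open>\<psi> \<in> F\<close> and \<open>(F, y) \<sim> (F, x)\<close>.
\<close>

definition hat_face :: "flag maniplex \<Rightarrow> nat \<Rightarrow> flag set \<Rightarrow> vec \<Rightarrow> flag set" where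
  "hat_face M i F x =
     {Hat \<psi> y | \<psi> y. \<psi> \<in> F \<and> y \<in> vecs M \<and>
        (\<forall>G\<in>supp (vec_add x y). face_le (i, F) (mrank M - 1, G))}"

definition hat_facet :: "flag maniplex \<Rightarrow> vec \<Rightarrow> flag set" where
  "hat_facet M x = hat_face M (mrank M) (flags M) x"

section \<open>The sets \<open>S\<^sub>j\<close>, base edges and \<open>\<rho>\<^sub>0\<close>\<close>

definition set_image :: "('f \<Rightarrow> 'f) \<Rightarrow> 'f set set \<Rightarrow> 'f set set" where
  "set_image \<gamma> S = (\<lambda>F. \<gamma> ` F) ` S"

definition admissible_S3 :: "flag set set \<Rightarrow> bool" where
  "admissible_S3 S \<longleftrightarrow>
     S \<subseteq> facets (MM 3) \<and>
     (\<forall>\<gamma>. automorphism (MM 3) \<gamma> \<and> set_image \<gamma> S = S \<longrightarrow> \<gamma> = id) \<and>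
     (\<forall>u\<in>faces (MM 3) 0. \<forall>v\<in>faces (MM 3) 0.
        \<not> S \<subseteq> {G \<in> facets (MM 3). incident u G} \<union> {G \<in> facets (MM 3). incident v G})"

text \<open>\<open>SS S3 j\<close> is \<open>S\<^sub>j\<close> for \<open>j \<ge> 3\<close>, built from \<open>S\<^sub>3 = S3\<close>.\<close>

primrec SS :: "flag set set \<Rightarrow> nat \<Rightarrow> flag set set" where
  "SS S3 0 = S3"
| "SS S3 (Suc j) =
     (if Suc j \<le> 3 then S3
      else {hat_facet (MM j) (chi F) | F. F \<in> SS S3 j} \<union> {hat_facet (MM j) zero_vec})"

text \<open>The base edge of the facet \<open>(f, x)\<close> of \<open>M\<^sub>n\<close>, where \<open>f\<close> is the greatest face of \<open>M\<^sub>n\<^sub>-\<^sub>1\<close> and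
  \<open>e\<close> is a fixed 1-face of \<open>M\<^sub>n\<^sub>-\<^sub>1\<close>.\<close>

definition base_edge :: "nat \<Rightarrow> flag set set \<Rightarrow> flag set \<Rightarrow> vec \<Rightarrow> flag set" where
  "base_edge n S3 e x =
     (let M = MM (n - 1);
          P = (\<lambda>\<gamma>. automorphism M \<gamma> \<and> supp x = set_image \<gamma> (SS S3 (n - 1)))
      in hat_face M 1 (if \<exists>\<gamma>. P \<gamma> then (THE \<gamma>. P \<gamma>) ` e else e) x)"

text \<open>
  \<open>\<rho>\<close> is the permutation of the flags of \<open>M\<^sub>n\<close> that acts on each facet \<open>F\<close> as the automorphism of \<open>F\<close>
  sending \<open>\<Phi>\<^sub>F\<close> to its 0-neighbor, for some flags \<open>\<Phi>\<^sub>F\<close> chosen in \<open>F\<close> with the base edge of \<open>F\<close> as 1-face.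
\<close>

definition is_rho0 :: "nat \<Rightarrow> flag set set \<Rightarrow> flag set \<Rightarrow> (flag \<Rightarrow> flag) \<Rightarrow> bool" where
  "is_rho0 n S3 e \<rho> \<longleftrightarrow>
     \<rho> permutes flags (MM n) \<and>
     (\<forall>x\<in>vecs (MM (n - 1)).
        let F = hat_facet (MM (n - 1)) x in
        \<exists>\<Phi>\<in>F. face_at (MM n) 1 \<Phi> = base_edge n S3 e x \<and>
          (\<exists>\<alpha>. automorphism (facet_maniplex (MM n) F) \<alpha> \<and> \<alpha> \<Phi> = adj (MM n) 0 \<Phi> \<and>
             (\<forall>\<Psi>\<in>F. \<rho> \<Psi> = \<alpha> \<Psi>)))"

section \<open>The voltage assignment\<close>

definition white_flags :: "nat \<Rightarrow> (flag \<Rightarrow> vertex) \<Rightarrow> flag set" where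
  "white_flags n p = {\<Phi> \<in> flags (MM n). p \<Phi> = White}"

text \<open>The set of white flags times the integers modulo \<open>2l\<close>, the latter represented by
  \<open>0, \<dots>, 2l - 1\<close>.\<close>

definition white_points :: "nat \<Rightarrow> (flag \<Rightarrow> vertex) \<Rightarrow> nat \<Rightarrow> (flag \<times> nat) set" where
  "white_points n p l = white_flags n p \<times> {0..<2 * l}"

definition white_action ::
    "nat \<Rightarrow> (flag \<Rightarrow> vertex) \<Rightarrow> nat \<Rightarrow> (flag \<Rightarrow> flag) \<Rightarrow> flag \<times> nat \<Rightarrow> flag \<times> nat" where
  "white_action n p l \<omega> =
     (\<lambda>(\<Psi>, c). if (\<Psi>, c) \<in> white_points n p l then (\<omega> \<Psi>, c) else (\<Psi>, c))"

definition y_tilde ::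
    "nat \<Rightarrow> (flag \<Rightarrow> vertex) \<Rightarrow> nat \<Rightarrow> (flag \<Rightarrow> flag) \<Rightarrow> (flag \<times> nat \<Rightarrow> flag \<times> nat)
       \<Rightarrow> flag \<times> nat \<Rightarrow> flag \<times> nat" where
  "y_tilde n p l \<rho> s = white_action n p l (\<rho> \<circ>> adj (MM n) 0) \<circ>> s"

definition xi ::
    "nat \<Rightarrow> nat set \<Rightarrow> (flag \<Rightarrow> vertex) \<Rightarrow> nat \<Rightarrow> (flag \<Rightarrow> flag) \<Rightarrow> (flag \<times> nat \<Rightarrow> flag \<times> nat)
       \<Rightarrow> vertex \<times> nat \<Rightarrow> flag \<times> nat \<Rightarrow> flag \<times> nat" where
  "xi n I p l \<rho> s = (\<lambda>(v, i).
     let r = adj (MM n) in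
     if i = 0 then id
     else if i = n then y_tilde n p l \<rho> s
     else white_action n p l
       (if i \<in> I
        then (case v of White \<Rightarrow> r i | Black \<Rightarrow> r 0 \<circ>> r i \<circ>> r 0)
        else (case v of White \<Rightarrow> r 0 \<circ>> r i | Black \<Rightarrow> r i \<circ>> r 0)))"

end

theory Submission
  imports Defs
begin

text \<open>
  For \<open>m = n\<close> the claim is clear from inclusions of color sets, so let \<open>m < n\<close>. Write \<open>r\<^sub>i\<close> for
  the permutation of color \<open>i\<close> and represent a flag of the color of a vertex by the white flag
  among it and its 0-neighbor. In these coordinates the voltage of a walk from \<open>a\<close> to \<open>b\<close> is a
  plain word in \<open>r\<^sub>0, \<dots>, r\<^sub>n\<^sub>-\<^sub>1\<close> and \<open>\<rho>\<close>, the latter for color \<open>n\<close>, applied to flags of the color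
  of \<open>b\<close> (\<open>walk_voltage_formula\<close>). A common voltage therefore gives words \<open>u\<close> in the colors up to
  \<open>m\<close> and \<open>v\<close> in the colors from \<open>k\<close> on that agree on all flags of the color of \<open>b\<close>. It suffices
  to remove \<open>\<rho>\<close> from \<open>v\<close>: the intersection property of the regular polytope \<open>M\<^sub>n\<close> then yields a
  word \<open>h\<close> in the colors from \<open>k\<close> to \<open>m\<close> equal to \<open>u\<close>, and \<open>h\<close> lifts to a walk from \<open>a\<close> to \<open>b\<close>
  because both words change the color of flags in the same way.

  The removal of \<open>\<rho>\<close> (\<open>rho_free_replacement\<close>) compares two kinds of flags in the facet of \<open>M\<^sub>n\<close>
  with vector 0. On a facet whose base edge is the standard edge \<open>e\<close>, \<open>\<rho>\<close> is the reflection of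
  \<open>M\<^sub>n\<^sub>-\<^sub>1\<close> exchanging the ends of \<open>e\<close>. Starting on \<open>e\<close> itself this is color 0, so \<open>v\<close> acts like
  the word obtained by writing 0 for each \<open>\<rho>\<close>; as \<open>M\<^sub>n\<close> is regular, agreement with \<open>u\<close> at one flag
  spreads to all flags. Starting on an edge next to \<open>e\<close> in a square 2-face, each \<open>\<rho>\<close> moves to the
  opposite edge of the square, which words without color 1 cannot do. Hence \<open>\<rho>\<close> occurs an even
  number of times, and the zeros replacing it cancel, since \<open>k > 1\<close> makes color 0 commute with all
  other letters.

  All this requires that only facets with the standard base edge are met. Along \<open>v\<close> the vector
  stays supported on facets at one of two vertices of \<open>M\<^sub>n\<^sub>-\<^sub>1\<close>, those of the start flag and of
  its mirror image (\<open>generic_walk\<close>), while the exceptional supports \<open>S\<^sub>n\<^sub>-\<^sub>1\<gamma>\<close> are never covered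
  by two vertices: this is assumed for \<open>S\<^sub>3\<close> and inherited by each later \<open>S\<^sub>j\<close>
  (\<open>vertex_spread_hat\<close>).
\<close>

section \<open>Words of colors and regular polytopes\<close>

text \<open>The last letter of the word acts first.\<close>

abbreviation word :: "'f maniplex \<Rightarrow> nat list \<Rightarrow> 'f \<Rightarrow> 'f" where
  "word M w \<equiv> foldr (adj M) w"

lemma foldr_equivariant:
  assumes "\<And>i x. i \<in> J \<Longrightarrow> x \<in> A \<Longrightarrow> g i x \<in> A \<and> f (g i x) = h i (f x)"
    and "set w \<subseteq> J" and "x \<in> A"
  shows "foldr g w x \<in> A \<and> f (foldr g w x) = foldr h w (f x)"
  using assms(2) by (induction w) (use assms(1,3) in auto)

text \<open>
  An injective endomorphism; on a finite flag set it is an automorphism as far as the flags are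
  concerned. In contrast to \<^const>\<open>automorphism\<close> its values outside the flag set are arbitrary, so that
  the extension of a symmetry to the hat has a closed formula.
\<close>

definition symmetry :: "'f maniplex \<Rightarrow> ('f \<Rightarrow> 'f) \<Rightarrow> bool" where
  "symmetry M \<gamma> \<longleftrightarrow> inj_on \<gamma> (flags M) \<and> \<gamma> ` flags M \<subseteq> flags M \<and>
     (\<forall>i<mrank M. \<forall>\<Phi>\<in>flags M. \<gamma> (adj M i \<Phi>) = adj M i (\<gamma> \<Phi>))"

lemma automorphism_symmetry: "automorphism M \<gamma> \<Longrightarrow> symmetry M \<gamma>"
  by (auto simp: automorphism_def symmetry_def permutes_image intro: permutes_inj_on)

text \<open>
  The properties of the flag graph of a finite regular polytope that are inherited by its hat. The
  last one is the intersection property of the monodromy group, stated at a single flag; by flag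
  transitivity (\<open>word_eq_transfer\<close>) the equation of words that it yields holds at all flags.
\<close>

locale regular_polytope =
  fixes M :: "'f maniplex"
  assumes rank_pos: "0 < mrank M"
    and flags_nonempty: "flags M \<noteq> {}"
    and finite_flags: "finite (flags M)"
    and adj_flag: "\<lbrakk>\<Phi> \<in> flags M; i < mrank M\<rbrakk> \<Longrightarrow> adj M i \<Phi> \<in> flags M"
    and adj_adj: "\<lbrakk>\<Phi> \<in> flags M; i < mrank M\<rbrakk> \<Longrightarrow> adj M i (adj M i \<Phi>) = \<Phi>"
    and adj_commute: "\<lbrakk>\<Phi> \<in> flags M; i + 1 < j; j < mrank M\<rbrakk>
      \<Longrightarrow> adj M i (adj M j \<Phi>) = adj M j (adj M i \<Phi>)"
    and connected: "\<lbrakk>\<Phi> \<in> flags M; \<Psi> \<in> flags M\<rbrakk>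
      \<Longrightarrow> \<exists>w. set w \<subseteq> {..<mrank M} \<and> \<Psi> = word M w \<Phi>"
    and flag_transitive: "\<lbrakk>\<Phi> \<in> flags M; \<Psi> \<in> flags M\<rbrakk> \<Longrightarrow> \<exists>\<gamma>. symmetry M \<gamma> \<and> \<gamma> \<Phi> = \<Psi>"
    and intersection_property:
      "\<lbrakk>\<Phi> \<in> flags M; set u \<subseteq> {..<mrank M} \<inter> {..m}; set v \<subseteq> {..<mrank M} \<inter> {k..};
        word M u \<Phi> = word M v \<Phi>\<rbrakk>
      \<Longrightarrow> \<exists>h. set h \<subseteq> {..<mrank M} \<inter> {k..m} \<and> word M u \<Phi> = word M h \<Phi>"
begin

lemma word_flag: "\<lbrakk>\<Phi> \<in> flags M; set w \<subseteq> {..<mrank M}\<rbrakk> \<Longrightarrow> word M w \<Phi> \<in> flags M"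
  by (induction w) (auto intro: adj_flag)

lemma symmetry_word:
  assumes "symmetry M \<gamma>" "\<Phi> \<in> flags M" "set w \<subseteq> {..<mrank M}"
  shows "\<gamma> (word M w \<Phi>) = word M w (\<gamma> \<Phi>)"
  using foldr_equivariant[of "{..<mrank M}" "flags M" "adj M" \<gamma> "adj M" w \<Phi>] assms
  by (auto simp: symmetry_def adj_flag)

text \<open>
  The monodromy group acts freely: symmetries commute with words and move any flag to any other.
\<close>

lemma word_eq_transfer:
  assumes "word M u \<Phi> = word M v \<Phi>" "set u \<subseteq> {..<mrank M}" "set v \<subseteq> {..<mrank M}"
    and "\<Phi> \<in> flags M" "\<Psi> \<in> flags M"
  shows "word M u \<Psi> = word M v \<Psi>"
proof -
  obtain \<gamma> where "symmetry M \<gamma>" "\<gamma> \<Phi> = \<Psi>" using flag_transitive assms by blast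
  then show ?thesis using assms by (metis symmetry_word)
qed

lemma component_eq_words:
  assumes "\<Phi> \<in> flags M" "J \<subseteq> {..<mrank M}"
  shows "component M J \<Phi> = {word M w \<Phi> | w. set w \<subseteq> J}"
proof (intro equalityI subsetI)
  fix \<Psi> assume "\<Psi> \<in> component M J \<Phi>"
  then have "(\<Phi>, \<Psi>) \<in> {(\<Psi>, adj M i \<Psi>) | \<Psi> i. \<Psi> \<in> flags M \<and> i \<in> J}\<^sup>*"
    by (simp add: component_def)
  then show "\<Psi> \<in> {word M w \<Phi> | w. set w \<subseteq> J}"
  proof induction
    case base
    show ?case by (rule CollectI, rule exI[of _ "[]"]) simp
  next
    case (step \<Psi> \<Theta>)
    then obtain w i where "set w \<subseteq> J" "\<Psi> = word M w \<Phi>" "i \<in> J" "\<Theta> = adj M i \<Psi>" by blast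
    then show ?case by (intro CollectI exI[of _ "i # w"]) auto
  qed
next
  fix \<Psi> assume "\<Psi> \<in> {word M w \<Phi> | w. set w \<subseteq> J}"
  then obtain w where "set w \<subseteq> J" "\<Psi> = word M w \<Phi>" by blast
  moreover have "set w \<subseteq> J \<Longrightarrow>
      (\<Phi>, word M w \<Phi>) \<in> {(\<Psi>, adj M i \<Psi>) | \<Psi> i. \<Psi> \<in> flags M \<and> i \<in> J}\<^sup>*" for w
  proof (induction w)
    case (Cons i w)
    moreover have "word M w \<Phi> \<in> flags M" using word_flag[OF assms(1), of w] Cons assms by auto
    ultimately show ?case by (fastforce intro: rtrancl_into_rtrancl)
  qed simp
  ultimately show "\<Psi> \<in> component M J \<Phi>" by (simp add: component_def)
qed

lemma component_flags:
  "\<lbrakk>\<Phi> \<in> flags M; J \<subseteq> {..<mrank M}\<rbrakk> \<Longrightarrow> component M J \<Phi> \<subseteq> flags M"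
  by (auto simp: component_eq_words intro!: word_flag)

lemma component_adj_subset:
  assumes "\<Phi> \<in> flags M" "J \<subseteq> {..<mrank M}" "i \<in> J"
  shows "component M J (adj M i \<Phi>) \<subseteq> component M J \<Phi>"
proof
  fix \<Psi> assume "\<Psi> \<in> component M J (adj M i \<Phi>)"
  moreover have "adj M i \<Phi> \<in> flags M" using assms adj_flag by auto
  ultimately obtain w where "set w \<subseteq> J" "\<Psi> = word M w (adj M i \<Phi>)"
    using assms by (auto simp: component_eq_words)
  then have "\<Psi> = word M (w @ [i]) \<Phi>" "set (w @ [i]) \<subseteq> J" using assms by auto
  then show "\<Psi> \<in> component M J \<Phi>"
    unfolding component_eq_words[OF assms(1,2)] by blast
qed

lemma component_adj:
  assumes "\<Phi> \<in> flags M" "J \<subseteq> {..<mrank M}" "i \<in> J"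
  shows "component M J (adj M i \<Phi>) = component M J \<Phi>"
  using component_adj_subset[OF assms] component_adj_subset[of "adj M i \<Phi>" J i] assms
  by (metis adj_adj adj_flag lessThan_iff subset_antisym subset_iff)

lemma component_word:
  assumes "\<Phi> \<in> flags M" "J \<subseteq> {..<mrank M}" "set w \<subseteq> J"
  shows "component M J (word M w \<Phi>) = component M J \<Phi>"
  using assms(3)
proof (induction w)
  case (Cons i w)
  then have "word M w \<Phi> \<in> flags M" using assms word_flag[of \<Phi> w] by auto
  with Cons assms component_adj show ?case by auto
qed simp

lemma self_in_component: "\<Phi> \<in> component M J \<Phi>"
  by (simp add: component_def)

lemma face_at_adj:
  "\<lbrakk>\<Phi> \<in> flags M; j < mrank M; j \<noteq> i\<rbrakk> \<Longrightarrow> face_at M i (adj M j \<Phi>) = face_at M i \<Phi>"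
  unfolding face_at_def by (rule component_adj) auto

lemma face_at_flags: "\<Phi> \<in> flags M \<Longrightarrow> face_at M i \<Phi> \<subseteq> flags M"
  unfolding face_at_def by (rule component_flags) auto

lemma self_in_face_at: "\<Phi> \<in> face_at M i \<Phi>"
  unfolding face_at_def by (rule self_in_component)

lemma face_at_incident_facet_at: "incident (face_at M i \<Phi>) (facet_at M \<Phi>)"
  unfolding incident_def facet_at_def using self_in_face_at by blast

lemma symmetry_image_face_at:
  assumes "symmetry M \<gamma>" "\<Phi> \<in> flags M"
  shows "\<gamma> ` face_at M i \<Phi> = face_at M i (\<gamma> \<Phi>)"
proof -
  have "\<gamma> \<Phi> \<in> flags M" using assms by (auto simp: symmetry_def)
  moreover have "\<gamma> (word M w \<Phi>) = word M w (\<gamma> \<Phi>)" if "set w \<subseteq> {..<mrank M} - {i}" for w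
    using symmetry_word[OF assms, of w] that by auto
  ultimately show ?thesis using assms(2) unfolding face_at_def
    by (subst (1 2) component_eq_words) (auto 4 4 simp: image_iff)
qed

lemma facet_in_facets: "\<Phi> \<in> flags M \<Longrightarrow> facet_at M \<Phi> \<in> facets M"
  by (simp add: facets_def faces_def facet_at_def)

lemma facets_cases:
  assumes "F \<in> facets M" obtains \<Phi> where "\<Phi> \<in> flags M" "F = facet_at M \<Phi>"
  using assms by (auto simp: facets_def faces_def facet_at_def)

lemma facet_flags: "F \<in> facets M \<Longrightarrow> F \<subseteq> flags M"
  by (erule facets_cases) (simp add: facet_at_def face_at_flags)

lemma finite_facet: "F \<in> facets M \<Longrightarrow> finite F"
  using facet_flags finite_flags finite_subset by blast

lemma finite_facets: "finite (facets M)"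
  using finite_flags by (simp add: facets_def faces_def)

end

section \<open>Vectors over the two-element field\<close>

lemma supp_vec_add: "supp (vec_add x y) = (supp x - supp y) \<union> (supp y - supp x)"
  unfolding supp_def vec_add_def
  by (auto simp: fset_inject)

lemma supp_inject: "supp x = supp y \<longleftrightarrow> x = y"
  unfolding supp_def by (metis fset_inject inj_image_eq_iff injI)

lemma supp_chi: "finite F \<Longrightarrow> supp (chi F) = {F}"
  by (simp add: supp_def chi_def Abs_fset_inverse)

lemma supp_zero: "supp zero_vec = {}"
  by (simp add: supp_def zero_vec_def)

lemma vec_add_cancel: "vec_add (vec_add x y) y = x"
  unfolding supp_inject[symmetric] supp_vec_add by blast

lemma vec_add_right_commute: "vec_add (vec_add x y) z = vec_add (vec_add x z) y"
  unfolding supp_inject[symmetric] supp_vec_add by blast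

lemma supp_image: "supp (fimage (fimage \<gamma>) x) = set_image \<gamma> (supp x)"
  by (auto simp: supp_def set_image_def image_iff)

lemma vecs_add: "\<lbrakk>x \<in> vecs M; y \<in> vecs M\<rbrakk> \<Longrightarrow> vec_add x y \<in> vecs M"
  by (auto simp: vecs_def supp_vec_add)

lemma zero_in_vecs: "zero_vec \<in> vecs M"
  by (simp add: vecs_def supp_zero)

section \<open>The passage from a polytope to its hat\<close>

locale flag_polytope = regular_polytope M for M :: "flag maniplex"
begin

lemma finite_vecs: "finite (vecs M)"
proof (rule finite_imageD)
  show "finite (supp ` vecs M)"
    using finite_facets by (auto simp: vecs_def intro: finite_subset[of _ "Pow (facets M)"])
  show "inj_on supp (vecs M)" by (auto simp: inj_on_def supp_inject)
qed

lemma chi_in_vecs: "F \<in> facets M \<Longrightarrow> chi F \<in> vecs M"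
  using finite_facet by (simp add: vecs_def supp_chi)

lemma supp_chi_facet: "F \<in> facets M \<Longrightarrow> supp (chi F) = {F}"
  by (simp add: supp_chi finite_facet)

lemma adj_hat_low: "i < mrank M \<Longrightarrow> adj (hat M) i (Hat \<Phi> x) = Hat (adj M i \<Phi>) x"
  by (simp add: hat_def)

lemma adj_hat_top: "adj (hat M) (mrank M) (Hat \<Phi> x) = Hat \<Phi> (vec_add x (chi (facet_at M \<Phi>)))"
  by (simp add: hat_def)

lemma mrank_hat: "mrank (hat M) = Suc (mrank M)"
  by (simp add: hat_def)

lemma Hat_in_flags: "Hat \<Phi> x \<in> flags (hat M) \<longleftrightarrow> \<Phi> \<in> flags M \<and> x \<in> vecs M"
  by (auto simp: hat_def)

lemma flags_hat_cases:
  assumes "\<Theta> \<in> flags (hat M)"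
  obtains \<Phi> x where "\<Theta> = Hat \<Phi> x" "\<Phi> \<in> flags M" "x \<in> vecs M"
  using assms by (auto simp: hat_def)

lemma adj_hat_flag:
  assumes "\<Theta> \<in> flags (hat M)" "i < mrank (hat M)"
  shows "adj (hat M) i \<Theta> \<in> flags (hat M)"
  using assms(1)
proof (cases rule: flags_hat_cases)
  case (1 \<Phi> x)
  then show ?thesis using assms(2)
    by (cases "i < mrank M")
      (auto simp: mrank_hat less_Suc_eq adj_hat_low adj_hat_top Hat_in_flags adj_flag
        intro!: vecs_add chi_in_vecs facet_in_facets)
qed

lemma word_hat_low:
  "set w \<subseteq> {..<mrank M} \<Longrightarrow> word (hat M) w (Hat \<Phi> x) = Hat (word M w \<Phi>) x"
  by (induction w) (auto simp: adj_hat_low)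

lemma word_hat:
  "set w \<subseteq> {..mrank M} \<Longrightarrow>
     \<exists>y. word (hat M) w (Hat \<Phi> x) = Hat (word M (filter (\<lambda>i. i < mrank M) w) \<Phi>) y"
proof (induction w)
  case (Cons i w)
  then obtain y where "word (hat M) w (Hat \<Phi> x) = Hat (word M (filter (\<lambda>i. i < mrank M) w) \<Phi>) y"
    by auto
  then show ?case using Cons.prems
    by (cases "i = mrank M") (auto simp: adj_hat_low adj_hat_top)
qed simp

text \<open>
  To reach the vector \<open>x\<close>, its facets are switched on one after the other: inside \<open>M\<close> one walks to
  a flag of the next facet and then uses the new color.
\<close>

lemma connected_hat_zero:
  assumes "\<Phi> \<in> flags M" "x \<in> vecs M" "\<Psi> \<in> flags M"
  shows "\<exists>w. set w \<subseteq> {..mrank M} \<and> Hat \<Psi> x = word (hat M) w (Hat \<Phi> zero_vec)"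
  using assms(2,3)
proof (induction x arbitrary: \<Psi>)
  case empty
  obtain w where "set w \<subseteq> {..<mrank M}" "\<Psi> = word M w \<Phi>"
    using connected assms empty by blast
  then show ?case
    by (intro exI[of _ w]) (auto simp: word_hat_low zero_vec_def)
next
  case (insert A x)
  then have F: "fset A \<in> facets M" and x: "x \<in> vecs M" by (auto simp: vecs_def supp_def)
  obtain \<Phi>' where \<Phi>': "\<Phi>' \<in> flags M" "fset A = facet_at M \<Phi>'" using F by (rule facets_cases)
  obtain w where w: "set w \<subseteq> {..mrank M}" "Hat \<Phi>' x = word (hat M) w (Hat \<Phi> zero_vec)"
    using insert.IH[OF x \<Phi>'(1)] by blast
  obtain v where v: "set v \<subseteq> {..<mrank M}" "\<Psi> = word M v \<Phi>'"
    using connected \<Phi>' insert.prems by blast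
  have "vec_add x (chi (fset A)) = finsert A x"
    using insert.hyps by (auto simp: vec_add_def chi_def fset_inverse)
  then have "Hat \<Psi> (finsert A x) = word (hat M) v (adj (hat M) (mrank M) (Hat \<Phi>' x))"
    using v \<Phi>' by (simp add: adj_hat_top word_hat_low)
  then have "Hat \<Psi> (finsert A x) = word (hat M) (v @ mrank M # w) (Hat \<Phi> zero_vec)"
    using w by simp
  then show ?case using w v by (intro exI[of _ "v @ mrank M # w"]) (auto intro: less_imp_le)
qed

text \<open>
  A symmetry \<open>\<gamma>\<close> of \<open>M\<close> permutes the facets, hence acts on vectors, and this action may be
  followed by a translation by \<open>t\<close>.
\<close>

lemma symmetry_hat:
  assumes "symmetry M \<gamma>" "t \<in> vecs M"
  defines "G \<equiv> fimage (fimage \<gamma>)"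
  defines "\<gamma>' \<equiv> (\<lambda>\<Theta>. case \<Theta> of Hat \<Phi> x \<Rightarrow> Hat (\<gamma> \<Phi>) (vec_add (G x) t) | _ \<Rightarrow> \<Theta>)"
  shows "symmetry (hat M) \<gamma>'"
proof -
  have \<gamma>: "inj_on \<gamma> (flags M)" "\<And>\<Phi>. \<Phi> \<in> flags M \<Longrightarrow> \<gamma> \<Phi> \<in> flags M"
    "\<And>i \<Phi>. \<lbrakk>i < mrank M; \<Phi> \<in> flags M\<rbrakk> \<Longrightarrow> \<gamma> (adj M i \<Phi>) = adj M i (\<gamma> \<Phi>)"
    using assms(1) by (auto simp: symmetry_def)
  have facet: "\<gamma> ` facet_at M \<Phi> = facet_at M (\<gamma> \<Phi>)" if "\<Phi> \<in> flags M" for \<Phi>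
    using symmetry_image_face_at[OF assms(1) that] by (simp add: facet_at_def)
  have inj: "inj_on (image \<gamma>) (facets M)"
    using inj_on_image_Pow[OF \<gamma>(1)] facet_flags by (auto intro: inj_on_subset)
  have suppG: "supp (G x) = image \<gamma> ` supp x" for x
    by (simp add: G_def supp_image set_image_def)
  have G: "G x \<in> vecs M" if "x \<in> vecs M" for x
    using that by (auto simp: vecs_def suppG facet \<gamma>(2) elim!: facets_cases
        intro!: facet_in_facets dest!: subsetD)
  have Gadd: "G (vec_add x y) = vec_add (G x) (G y)" if "x \<in> vecs M" "y \<in> vecs M" for x y
  proof -
    have sub: "supp x \<subseteq> facets M" "supp y \<subseteq> facets M" using that by (auto simp: vecs_def)
    have "image \<gamma> ` (A - B) = image \<gamma> ` A - image \<gamma> ` B"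
      if "A \<subseteq> facets M" "B \<subseteq> facets M" for A B
      using that by (intro inj_on_image_set_diff[OF inj]) auto
    then show ?thesis
      unfolding supp_inject[symmetric] suppG supp_vec_add image_Un by (simp add: sub)
  qed
  have Ginj: "x = y" if "G x = G y" "x \<in> vecs M" "y \<in> vecs M" for x y
    using that inj unfolding supp_inject[symmetric] suppG vecs_def
    by (auto simp: inj_on_image_eq_iff)
  have Gchi: "G (chi (facet_at M \<Phi>)) = chi (facet_at M (\<gamma> \<Phi>))" if "\<Phi> \<in> flags M" for \<Phi>
    using that unfolding supp_inject[symmetric] suppG
    by (simp add: supp_chi_facet facet_in_facets facet \<gamma>(2))
  show ?thesis unfolding symmetry_def
  proof (intro conjI allI impI ballI)
    show "inj_on \<gamma>' (flags (hat M))"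
    proof (rule inj_onI)
      fix \<Theta> \<Theta>' assume "\<Theta> \<in> flags (hat M)" "\<Theta>' \<in> flags (hat M)" and eq: "\<gamma>' \<Theta> = \<gamma>' \<Theta>'"
      then obtain \<Phi> x \<Phi>' x' where *: "\<Theta> = Hat \<Phi> x" "\<Phi> \<in> flags M" "x \<in> vecs M"
        "\<Theta>' = Hat \<Phi>' x'" "\<Phi>' \<in> flags M" "x' \<in> vecs M"
        by (metis flags_hat_cases)
      then have "\<gamma> \<Phi> = \<gamma> \<Phi>'" "G x = G x'"
        using eq vec_add_cancel by (simp_all add: \<gamma>'_def) metis
      then show "\<Theta> = \<Theta>'" using * \<gamma>(1) Ginj by (auto dest: inj_onD)
    qed
    show "\<gamma>' ` flags (hat M) \<subseteq> flags (hat M)"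
      by (auto elim!: flags_hat_cases simp: \<gamma>'_def Hat_in_flags \<gamma> G intro!: vecs_add assms(2))
    fix i \<Theta> assume i: "i < mrank (hat M)" and "\<Theta> \<in> flags (hat M)"
    then obtain \<Phi> x where *: "\<Theta> = Hat \<Phi> x" "\<Phi> \<in> flags M" "x \<in> vecs M" by (metis flags_hat_cases)
    show "\<gamma>' (adj (hat M) i \<Theta>) = adj (hat M) i (\<gamma>' \<Theta>)"
    proof (cases "i < mrank M")
      case True
      then show ?thesis using * by (simp add: adj_hat_low \<gamma>'_def \<gamma>(3))
    next
      case False
      then have "i = mrank M" using i by (simp add: mrank_hat)
      then show ?thesis using *
        by (simp add: adj_hat_top \<gamma>'_def Gadd Gchi chi_in_vecs facet_in_facets vec_add_right_commute)
    qed
  qed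
qed

text \<open>
  The intersection property passes to the hat for a simple reason. If \<open>m\<close> is at least the new
  color, the word on the right is already of the desired form. Otherwise the left word acts on the
  first coordinate only. Dropping the new color from the right word does not change its action on
  this coordinate and gives an instance of the property in \<open>M\<close>, whose solution also leaves the
  vector alone.
\<close>

lemma regular_polytope_hat: "regular_polytope (hat M)"
proof
  show "0 < mrank (hat M)" by (simp add: mrank_hat)
  have "flags (hat M) = (\<lambda>(\<Phi>, x). Hat \<Phi> x) ` (flags M \<times> vecs M)" by (auto simp: hat_def)
  then show "flags (hat M) \<noteq> {}" "finite (flags (hat M))"
    using flags_nonempty zero_in_vecs[of M] by (auto simp: finite_flags finite_vecs)
  show closed: "adj (hat M) i \<Theta> \<in> flags (hat M)" if "\<Theta> \<in> flags (hat M)" "i < mrank (hat M)" for \<Theta> i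
    using that by (rule adj_hat_flag)
  show inv: "adj (hat M) i (adj (hat M) i \<Theta>) = \<Theta>"
    if "\<Theta> \<in> flags (hat M)" "i < mrank (hat M)" for \<Theta> i
    using that
    by (cases "i < mrank M")
      (auto elim!: flags_hat_cases
        simp: mrank_hat less_Suc_eq adj_hat_low adj_hat_top vec_add_cancel adj_adj)
  show "adj (hat M) i (adj (hat M) j \<Theta>) = adj (hat M) j (adj (hat M) i \<Theta>)"
    if "\<Theta> \<in> flags (hat M)" "i + 1 < j" "j < mrank (hat M)" for \<Theta> i j
    using that(1)
  proof (cases rule: flags_hat_cases)
    case (1 \<Phi> x)
    then show ?thesis using that(2,3) adj_commute[OF 1(2), of i j]
      by (cases "j < mrank M")
        (auto simp: mrank_hat less_Suc_eq adj_hat_low adj_hat_top facet_at_def face_at_adj)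
  qed
  show "\<exists>w. set w \<subseteq> {..<mrank (hat M)} \<and> \<Theta>' = word (hat M) w \<Theta>"
    if "\<Theta> \<in> flags (hat M)" "\<Theta>' \<in> flags (hat M)" for \<Theta> \<Theta>'
  proof -
    from that obtain \<Phi> x \<Phi>' x' where *: "\<Theta> = Hat \<Phi> x" "\<Phi> \<in> flags M" "x \<in> vecs M"
      "\<Theta>' = Hat \<Phi>' x'" "\<Phi>' \<in> flags M" "x' \<in> vecs M"
      by (metis flags_hat_cases)
    obtain u where u: "set u \<subseteq> {..mrank M}" "\<Theta> = word (hat M) u (Hat \<Phi> zero_vec)"
      using connected_hat_zero * by blast
    obtain v where v: "set v \<subseteq> {..mrank M}" "\<Theta>' = word (hat M) v (Hat \<Phi> zero_vec)"
      using connected_hat_zero * by blast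
    have zero: "Hat \<Phi> zero_vec \<in> flags (hat M)" using * by (simp add: Hat_in_flags zero_in_vecs)
    have "word (hat M) (rev u) (word (hat M) u \<Psi>) = \<Psi> \<and> word (hat M) u \<Psi> \<in> flags (hat M)"
      if "\<Psi> \<in> flags (hat M)" for \<Psi>
      using that u(1)
      by (induction u) (auto simp: inv closed mrank_hat less_Suc_eq_le)
    then have "\<Theta>' = word (hat M) (v @ rev u) \<Theta>" using u v zero by simp
    then show ?thesis using u(1) v(1)
      by (intro exI[of _ "v @ rev u"]) (auto simp: mrank_hat less_Suc_eq_le)
  qed
  show "\<exists>\<gamma>. symmetry (hat M) \<gamma> \<and> \<gamma> \<Theta> = \<Theta>'"
    if "\<Theta> \<in> flags (hat M)" "\<Theta>' \<in> flags (hat M)" for \<Theta> \<Theta>'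
  proof -
    from that obtain \<Phi> x \<Phi>' x' where *: "\<Theta> = Hat \<Phi> x" "\<Phi> \<in> flags M" "x \<in> vecs M"
      "\<Theta>' = Hat \<Phi>' x'" "\<Phi>' \<in> flags M" "x' \<in> vecs M"
      by (metis flags_hat_cases)
    obtain \<gamma> where \<gamma>: "symmetry M \<gamma>" "\<gamma> \<Phi> = \<Phi>'" using flag_transitive * by blast
    let ?y = "fimage (fimage \<gamma>) x"
    have "\<gamma> ` F \<in> facets M" if "F \<in> facets M" for F
      using that \<gamma> symmetry_image_face_at[OF \<gamma>(1)] 
      by (auto simp: facets_def faces_def symmetry_def)
    then have "?y \<in> vecs M" using *(3) by (auto simp: vecs_def supp_image set_image_def)
    then have "vec_add ?y x' \<in> vecs M" using * vecs_add by blast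
    moreover have "vec_add ?y (vec_add ?y x') = x'"
      unfolding supp_inject[symmetric] supp_vec_add by blast
    ultimately show ?thesis using symmetry_hat[OF \<gamma>(1)] * \<gamma>(2) by force
  qed
  show "\<exists>h. set h \<subseteq> {..<mrank (hat M)} \<inter> {k..m} \<and> word (hat M) u \<Theta> = word (hat M) h \<Theta>"
    if "\<Theta> \<in> flags (hat M)" "set u \<subseteq> {..<mrank (hat M)} \<inter> {..m}"
      and v: "set v \<subseteq> {..<mrank (hat M)} \<inter> {k..}" "word (hat M) u \<Theta> = word (hat M) v \<Theta>"
    for \<Theta> u v m k
  proof (cases "m < mrank M")
    case False
    then have "set v \<subseteq> {..<mrank (hat M)} \<inter> {k..m}" using v by (force simp: mrank_hat)
    then show ?thesis using that(4) by blast
  next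
    case True
    obtain \<Phi> x where *: "\<Theta> = Hat \<Phi> x" "\<Phi> \<in> flags M" "x \<in> vecs M"
      using \<open>\<Theta> \<in> flags (hat M)\<close> by (rule flags_hat_cases)
    let ?v = "filter (\<lambda>i. i < mrank M) v"
    have "set v \<subseteq> {..mrank M}" using v by (auto simp: mrank_hat)
    then obtain y where y: "word (hat M) v \<Theta> = Hat (word M ?v \<Phi>) y" using word_hat * by blast
    have u: "set u \<subseteq> {..<mrank M} \<inter> {..m}" using that(2) True by auto
    then have "word (hat M) u \<Theta> = Hat (word M u \<Phi>) x" using * by (simp add: word_hat_low)
    then have "word M u \<Phi> = word M ?v \<Phi>" using y that by simp
    moreover have "set ?v \<subseteq> {..<mrank M} \<inter> {k..}" using v by auto
    ultimately obtain h where "set h \<subseteq> {..<mrank M} \<inter> {k..m}" "word M u \<Phi> = word M h \<Phi>"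
      using intersection_property[of \<Phi> u m ?v k] * u by auto
    then show ?thesis using u *
      by (intro exI[of _ h]) (auto simp: word_hat_low mrank_hat)
  qed
qed

end

lemma flag_polytope_hat: "flag_polytope M \<Longrightarrow> flag_polytope (hat M)"
  by (simp add: flag_polytope.intro flag_polytope.regular_polytope_hat)

section \<open>The square\<close>

lemma nat_less_4_iff: "(v::nat) < 4 \<longleftrightarrow> v = 0 \<or> v = 1 \<or> v = 2 \<or> v = 3" by auto

lemma flags_square:
  "flags square = {Sq 0 0, Sq 1 0, Sq 1 1, Sq 2 1, Sq 2 2, Sq 3 2, Sq 3 3, Sq 0 3}"
  by (auto simp: square_def nat_less_4_iff)

lemma adj_square: "adj square = square_adj" and mrank_square: "mrank square = 2"
  by (simp_all add: square_def)

lemma symmetry_comp: "symmetry M \<gamma> \<Longrightarrow> symmetry M \<delta> \<Longrightarrow> symmetry M (\<gamma> \<circ> \<delta>)"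
  unfolding symmetry_def image_subset_iff
  by (auto intro!: comp_inj_on intro: inj_on_subset)

fun rotate_square :: "flag \<Rightarrow> flag" where
  "rotate_square (Sq v e) = Sq ((v + 1) mod 4) ((e + 1) mod 4)"
| "rotate_square (Hat \<Phi> x) = Hat \<Phi> x"

fun reflect_square :: "flag \<Rightarrow> flag" where
  "reflect_square (Sq v e) = Sq ((4 - v) mod 4) (3 - e)"
| "reflect_square (Hat \<Phi> x) = Hat \<Phi> x"

lemma nat_less_2_iff: "i < 2 \<longleftrightarrow> i = 0 \<or> i = (1::nat)" by auto

lemma symmetry_square: "symmetry square rotate_square" "symmetry square reflect_square"
  unfolding symmetry_def mrank_square adj_square flags_square nat_less_2_iff
  by (simp_all add: inj_on_insert all_conj_distrib)

lemma transitive_square: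
  assumes "\<Phi> \<in> flags square" "\<Psi> \<in> flags square"
  shows "\<exists>\<gamma>. symmetry square \<gamma> \<and> \<gamma> \<Phi> = \<Psi>"
proof -
  \<comment> \<open>The dihedral group of order 8, which contains an element moving any flag to \<open>Sq 0 0\<close>.\<close>
  let ?r = rotate_square and ?s = reflect_square
  let ?D = "{id, ?r, ?r \<circ> ?r, ?r \<circ> (?r \<circ> ?r),
    ?s, ?r \<circ> ?s, ?r \<circ> (?r \<circ> ?s), ?r \<circ> (?r \<circ> (?r \<circ> ?s))}"
  have "symmetry square id" by (simp add: symmetry_def)
  then have sym: "\<forall>\<gamma>\<in>?D. symmetry square \<gamma>"
    by (simp add: symmetry_comp symmetry_square)
  have "\<exists>\<gamma>\<in>?D. \<gamma> \<Phi> = Sq 0 0"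
    using assms(1) unfolding flags_square insert_iff empty_iff by (elim disjE) simp_all
  then obtain \<gamma> where "\<gamma> \<in> ?D" "\<gamma> \<Phi> = Sq 0 0" by blast
  moreover have "\<exists>\<gamma>\<in>?D. \<gamma> (Sq 0 0) = \<Psi>"
    using assms(2) unfolding flags_square insert_iff empty_iff by (elim disjE) simp_all
  then obtain \<delta> where "\<delta> \<in> ?D" "\<delta> (Sq 0 0) = \<Psi>" by blast
  ultimately have "symmetry square (\<delta> \<circ> \<gamma>)" "(\<delta> \<circ> \<gamma>) \<Phi> = \<Psi>"
    using sym symmetry_comp by (blast, simp)
  then show ?thesis by blast
qed

text \<open>
  The vertex and the edge of the square at which the nested construction of a flag starts. Only
  color 0 changes the former and only color 1 changes the latter.
\<close>

fun vertex_of :: "flag \<Rightarrow> nat" where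
  "vertex_of (Sq v e) = v"
| "vertex_of (Hat \<Phi> x) = vertex_of \<Phi>"

fun edge_of :: "flag \<Rightarrow> nat" where
  "edge_of (Sq v e) = e"
| "edge_of (Hat \<Phi> x) = edge_of \<Phi>"

lemma regular_polytope_square: "regular_polytope square"
proof
  show "0 < mrank square" by (simp add: mrank_square)
  show "flags square \<noteq> {}" "finite (flags square)" by (simp_all add: flags_square)
  show adj: "adj square i \<Phi> \<in> flags square" if "\<Phi> \<in> flags square" for \<Phi> i
    using that unfolding flags_square adj_square by (cases "i = 0") auto
  show "adj square i (adj square i \<Phi>) = \<Phi>" if "\<Phi> \<in> flags square" for \<Phi> i
    using that unfolding flags_square adj_square by (cases "i = 0") auto
  show "adj square i (adj square j \<Phi>) = adj square j (adj square i \<Phi>)"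
    if "\<Phi> \<in> flags square" "i + 1 < j" "j < mrank square" for \<Phi> i j
    using that by (simp add: mrank_square)
  show "\<exists>w. set w \<subseteq> {..<mrank square} \<and> \<Psi> = word square w \<Phi>"
    if "\<Phi> \<in> flags square" "\<Psi> \<in> flags square" for \<Phi> \<Psi>
  proof -
    have "\<exists>w\<in>{[], [0], [1], [0,1], [1,0], [0,1,0], [1,0,1], [0,1,0,1]}. \<Psi> = word square w \<Phi>"
      using that unfolding flags_square adj_square by auto
    then obtain w where "\<Psi> = word square w \<Phi>"
      and "w \<in> {[], [0], [1], [0,1], [1,0], [0,1,0], [1,0,1], [0,1,0,1]}" by blast
    then show ?thesis unfolding mrank_square by (intro exI[of _ w]) auto
  qed
  show "\<exists>\<gamma>. symmetry square \<gamma> \<and> \<gamma> \<Phi> = \<Psi>" if "\<Phi> \<in> flags square" "\<Psi> \<in> flags square" for \<Phi> \<Psi>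
    using that by (rule transitive_square)
  show "\<exists>h. set h \<subseteq> {..<mrank square} \<inter> {k..m} \<and> word square u \<Phi> = word square h \<Phi>"
    if \<Phi>: "\<Phi> \<in> flags square" and u: "set u \<subseteq> {..<mrank square} \<inter> {..m}"
      and v: "set v \<subseteq> {..<mrank square} \<inter> {k..}" and eq: "word square u \<Phi> = word square v \<Phi>"
    for \<Phi> u v m k
  proof (cases "k = 0 \<or> m \<noteq> 0")
    case True
    then show ?thesis
    proof
      assume "k = 0"
      then show ?thesis using u by (intro exI[of _ u]) auto
    next
      assume "m \<noteq> 0"
      then have "set v \<subseteq> {..<mrank square} \<inter> {k..m}"
        using v by (force simp: mrank_square)
      then show ?thesis using eq by blast
    qed
  next
    case False
    have *: "set w \<subseteq> {i} \<Longrightarrow> word square w \<Phi> \<in> flags square \<and>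
        (if i = 0 then edge_of (word square w \<Phi>) = edge_of \<Phi>
         else vertex_of (word square w \<Phi>) = vertex_of \<Phi>)" for w i
      using \<Phi> by (induction w) (auto simp: flags_square adj_square)
    have "set u \<subseteq> {0}" "set v \<subseteq> {1}" using False u v by (force simp: mrank_square)+
    from *[OF this(1)] *[OF this(2)] have "word square u \<Phi> = \<Phi>"
      using eq \<Phi> by (auto simp: flags_square)
    then show ?thesis by (intro exI[of _ "[]"]) simp
  qed
qed

section \<open>The family of maniplexes\<close>

lemma MM_Suc:
  assumes "2 \<le> n"
  shows "MM (Suc n) = hat (MM n)"
proof -
  have "Suc n - 2 = Suc (n - 2)" using assms by simp
  then show ?thesis unfolding MM_def by (simp del: diff_Suc_Suc)
qed

lemma MM_2: "MM 2 = square"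
  by (simp add: MM_def)

lemma flag_polytope_MM: "2 \<le> n \<Longrightarrow> flag_polytope (MM n)"
proof (induction n rule: dec_induct)
  case base
  show ?case by (simp add: MM_2 flag_polytope.intro regular_polytope_square)
qed (simp add: MM_Suc flag_polytope_hat)

lemma mrank_MM: "2 \<le> n \<Longrightarrow> mrank (MM n) = n"
proof (induction n rule: dec_induct)
  case (step n)
  then interpret flag_polytope "MM n" by (simp add: flag_polytope_MM)
  show ?case using step by (simp add: MM_Suc mrank_hat)
qed (simp add: MM_2 mrank_square)

lemma edge_of_adj_MM:
  assumes "2 \<le> n" "\<Phi> \<in> flags (MM n)" "i < n" "i \<noteq> 1"
  shows "edge_of (adj (MM n) i \<Phi>) = edge_of \<Phi>"
  using assms
proof (induction n arbitrary: \<Phi> rule: dec_induct)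
  case base
  then have "i = 0" by simp
  then show ?case using base by (auto simp: MM_2 adj_square flags_square)
next
  case (step n)
  then interpret flag_polytope "MM n" by (simp add: flag_polytope_MM)
  from step.prems obtain \<Psi> x where *: "\<Phi> = Hat \<Psi> x" "\<Psi> \<in> flags (MM n)"
    using step.hyps by (auto simp: MM_Suc elim: flags_hat_cases)
  show ?case using step mrank_MM[of n] * adj_hat_low[of i \<Psi> x] adj_hat_top[of \<Psi> x]
    by (cases "i = n") (auto simp: MM_Suc)
qed

text \<open>
  The two edges of a 2-face that are adjacent to a given edge of this 2-face are different, which
  is visible in the square at the core.
\<close>

lemma edge_of_neighbour_edges:
  assumes "2 \<le> n" "\<Phi> \<in> flags (MM n)"
  shows "edge_of (adj (MM n) 1 (adj (MM n) 0 \<Phi>)) \<noteq> edge_of (adj (MM n) 1 \<Phi>)"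
  using assms
proof (induction n arbitrary: \<Phi> rule: dec_induct)
  case base
  then show ?case by (auto simp: MM_2 adj_square flags_square)
next
  case (step n)
  then interpret flag_polytope "MM n" by (simp add: flag_polytope_MM)
  from step.prems obtain \<Psi> x where *: "\<Phi> = Hat \<Psi> x" "\<Psi> \<in> flags (MM n)"
    using step.hyps by (auto simp: MM_Suc elim: flags_hat_cases)
  then show ?case using step mrank_MM[of n] by (simp add: MM_Suc adj_hat_low)
qed

section \<open>Facets not covered by two vertices\<close>

context flag_polytope
begin

lemma facet_at_hat:
  assumes "\<Phi> \<in> flags M" "x \<in> vecs M"
  shows "facet_at (hat M) (Hat \<Phi> x) = {Hat \<Psi> x | \<Psi>. \<Psi> \<in> flags M}"
proof -
  interpret H: flag_polytope "hat M" by (rule flag_polytope_hat) unfold_locales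
  have "{..<Suc (mrank M)} - {mrank M} = {..<mrank M}" by auto
  then have "facet_at (hat M) (Hat \<Phi> x) = {word (hat M) w (Hat \<Phi> x) | w. set w \<subseteq> {..<mrank M}}"
    using assms unfolding facet_at_def face_at_def
    by (subst H.component_eq_words) (auto simp: mrank_hat Hat_in_flags)
  also have "\<dots> = {Hat (word M w \<Phi>) x | w. set w \<subseteq> {..<mrank M}}"
    by (intro Collect_cong ex_cong1) (auto simp: word_hat_low)
  also have "\<dots> = {Hat \<Psi> x | \<Psi>. \<Psi> \<in> flags M}"
    using connected assms by (blast intro: word_flag)
  finally show ?thesis .
qed

lemma hat_facet_eq:
  assumes "x \<in> vecs M"
  shows "hat_facet M x = {Hat \<Psi> x | \<Psi>. \<Psi> \<in> flags M}"
proof -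
  have "supp (vec_add x y) = {} \<longleftrightarrow> y = x" for y
    unfolding supp_inject[symmetric] supp_vec_add by blast
  moreover have "\<not> face_le (mrank M, F) (mrank M - 1, G)" for F and G :: "flag set"
    using rank_pos by (auto simp: face_le_def)
  ultimately show ?thesis using assms
    unfolding hat_facet_def hat_face_def by auto
qed

lemma hat_facet_in_facets:
  assumes "x \<in> vecs M"
  shows "hat_facet M x \<in> facets (hat M)"
proof -
  interpret H: flag_polytope "hat M" by (rule flag_polytope_hat) unfold_locales
  obtain \<Phi> where "\<Phi> \<in> flags M" using flags_nonempty by blast
  then show ?thesis using assms H.facet_in_facets[of "Hat \<Phi> x"]
    by (simp add: facet_at_hat hat_facet_eq Hat_in_flags)
qed

text \<open>
  Walking from \<open>(\<Phi>, x)\<close> without color 0 keeps the vertex of the \<open>M\<close>-coordinate, so only facets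
  that contain this vertex are added to \<open>x\<close> on the way.
\<close>

lemma vertex_incident_hat_facet:
  assumes "\<Phi> \<in> flags M" "x \<in> vecs M" "y \<in> vecs M"
    and "incident (face_at (hat M) 0 (Hat \<Phi> x)) (hat_facet M y)"
    and "G \<in> supp (vec_add x y)"
  shows "incident (face_at M 0 \<Phi>) G"
proof -
  interpret H: flag_polytope "hat M" by (rule flag_polytope_hat) unfold_locales
  have inv: "\<exists>\<Psi> z. word (hat M) w (Hat \<Phi> x) = Hat \<Psi> z \<and> \<Psi> \<in> flags M \<and> z \<in> vecs M \<and>
      face_at M 0 \<Psi> = face_at M 0 \<Phi> \<and> (\<forall>G\<in>supp (vec_add x z). incident (face_at M 0 \<Phi>) G)"
    if "set w \<subseteq> {..<mrank (hat M)} - {0}" for w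
    using that
  proof (induction w)
    case Nil
    then show ?case using assms by (auto simp: supp_vec_add)
  next
    case (Cons i w)
    then obtain \<Psi> z where *: "word (hat M) w (Hat \<Phi> x) = Hat \<Psi> z" "\<Psi> \<in> flags M" "z \<in> vecs M"
      "face_at M 0 \<Psi> = face_at M 0 \<Phi>" "\<forall>G\<in>supp (vec_add x z). incident (face_at M 0 \<Phi>) G"
      by auto
    show ?case
    proof (cases "i < mrank M")
      case True
      then show ?thesis using * Cons.prems by (auto simp: adj_hat_low adj_flag face_at_adj)
    next
      case False
      then have "i = mrank M" using Cons.prems by (auto simp: mrank_hat)
      moreover have "incident (face_at M 0 \<Phi>) (facet_at M \<Psi>)"
        using face_at_incident_facet_at[of 0 \<Psi>] * by simp
      ultimately show ?thesis using *
        by (auto simp: adj_hat_top supp_vec_add supp_chi_facet facet_in_facets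
            intro!: vecs_add chi_in_vecs)
    qed
  qed
  obtain \<Psi> where \<Psi>: "Hat \<Psi> y \<in> face_at (hat M) 0 (Hat \<Phi> x)"
    using assms by (auto simp: incident_def hat_facet_eq)
  then obtain w where "set w \<subseteq> {..<mrank (hat M)} - {0}" "word (hat M) w (Hat \<Phi> x) = Hat \<Psi> y"
    using assms unfolding face_at_def
    by (subst (asm) H.component_eq_words) (auto simp: Hat_in_flags)
  with inv assms show ?thesis by fastforce
qed

end

text \<open>
  The property of \<open>S\<^sub>3\<close> concerning two vertices, for an arbitrary maniplex; vertices are given by
  flags that contain them.
\<close>

definition vertex_spread :: "'f maniplex \<Rightarrow> 'f set set \<Rightarrow> bool" where
  "vertex_spread M S \<longleftrightarrow> S \<subseteq> facets M \<and>
     (\<forall>\<Phi>\<in>flags M. \<forall>\<Psi>\<in>flags M. \<exists>F\<in>S. \<not> incident (face_at M 0 \<Phi>) F \<and> \<not> incident (face_at M 0 \<Psi>) F)"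

text \<open>
  Suppose that the vertices of \<open>(\<Phi>, x)\<close> and \<open>(\<Psi>, y)\<close> cover the new set, the zero facet lying at
  the first. Then all facets in the support of \<open>x\<close> contain the vertex \<open>u\<close> of \<open>\<Phi>\<close>, so each \<open>F \<in> S\<close>
  whose facet \<open>\<chi>\<^sub>F\<close> lies at the first vertex contains \<open>u\<close>. For the remaining \<open>F\<close>, the vector \<open>y +
  \<chi>\<^sub>F\<close> is supported on facets at the vertex \<open>v\<close> of \<open>\<Psi>\<close>. If one of them, \<open>F\<^sub>0\<close>, misses \<open>v\<close>, then it
  lies in the support of \<open>y\<close> and no other \<open>F\<close> can cancel it. So \<open>S\<close> is covered by \<open>u\<close> and either
  \<open>v\<close> or an arbitrary vertex of \<open>F\<^sub>0\<close>, contrary to the assumption on \<open>S\<close>.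
\<close>

lemma (in flag_polytope) vertex_spread_hat:
  assumes "vertex_spread M S"
  shows "vertex_spread (hat M) ({hat_facet M (chi F) | F. F \<in> S} \<union> {hat_facet M zero_vec})"
    (is "vertex_spread _ ?S'")
proof -
  have S: "S \<subseteq> facets M" using assms by (simp add: vertex_spread_def)
  have spread: False
    if "\<Phi> \<in> flags M" "\<Psi> \<in> flags M"
      "\<And>F. F \<in> S \<Longrightarrow> incident (face_at M 0 \<Phi>) F \<or> incident (face_at M 0 \<Psi>) F" for \<Phi> \<Psi>
    using assms that unfolding vertex_spread_def by blast
  have main: False
    if \<Phi>: "\<Phi> \<in> flags M" "x \<in> vecs M" and \<Psi>: "\<Psi> \<in> flags M" "y \<in> vecs M"
      and zero: "incident (face_at (hat M) 0 (Hat \<Phi> x)) (hat_facet M zero_vec)"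
      and all: "\<And>F. F \<in> S \<Longrightarrow> incident (face_at (hat M) 0 (Hat \<Phi> x)) (hat_facet M (chi F)) \<or>
        incident (face_at (hat M) 0 (Hat \<Psi> y)) (hat_facet M (chi F))"
    for \<Phi> \<Psi> x y
  proof -
    have suppx: "incident (face_at M 0 \<Phi>) G" if "G \<in> supp x" for G
      using vertex_incident_hat_facet[OF \<Phi> zero_in_vecs zero, of G] that
      by (simp add: supp_vec_add supp_zero)
    have left: "incident (face_at M 0 \<Phi>) F"
      if "F \<in> S" "incident (face_at (hat M) 0 (Hat \<Phi> x)) (hat_facet M (chi F))" for F
      using vertex_incident_hat_facet[OF \<Phi> chi_in_vecs that(2), of F] suppx[of F] that(1) S
      by (auto simp: supp_vec_add supp_chi_facet)
    have right: "incident (face_at M 0 \<Psi>) G"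
      if "F \<in> S" "\<not> incident (face_at M 0 \<Phi>) F" "G \<in> supp (vec_add y (chi F))" for F G
      using vertex_incident_hat_facet[OF \<Psi> chi_in_vecs _ that(3)] left all that S by blast
    show False
    proof (cases "\<forall>F\<in>S. incident (face_at M 0 \<Phi>) F \<or> incident (face_at M 0 \<Psi>) F")
      case True
      then show False using spread \<Phi> \<Psi> by blast
    next
      case False
      then obtain F0 where F0: "F0 \<in> S" "\<not> incident (face_at M 0 \<Phi>) F0"
        "\<not> incident (face_at M 0 \<Psi>) F0" by blast
      have chi: "supp (chi F) = {F}" if "F \<in> S" for F using that S supp_chi_facet by blast
      \<comment> \<open>\<open>F0\<close> has to be cancelled by \<open>y\<close>, as it contains neither vertex.\<close>
      have "F0 \<in> supp y" using right[of F0 F0] F0 by (auto simp: supp_vec_add chi)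
      then have "F = F0" if "F \<in> S" "\<not> incident (face_at M 0 \<Phi>) F" for F
        using right[OF that, of F0] F0 that by (auto simp: supp_vec_add chi)
      moreover obtain \<Theta> where "\<Theta> \<in> flags M" "F0 = facet_at M \<Theta>"
        using F0 S by (blast elim: facets_cases)
      ultimately show False
        using spread[OF \<Phi>(1), of \<Theta>] face_at_incident_facet_at[of 0 \<Theta>] by blast
    qed
  qed
  show ?thesis unfolding vertex_spread_def
  proof (intro conjI ballI)
    show "?S' \<subseteq> facets (hat M)"
      using S by (auto intro!: hat_facet_in_facets chi_in_vecs zero_in_vecs)
    fix \<Theta> \<Theta>' assume "\<Theta> \<in> flags (hat M)" "\<Theta>' \<in> flags (hat M)"
    then obtain \<Phi> x \<Psi> y where *: "\<Theta> = Hat \<Phi> x" "\<Phi> \<in> flags M" "x \<in> vecs M"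
        "\<Theta>' = Hat \<Psi> y" "\<Psi> \<in> flags M" "y \<in> vecs M"
      by (metis flags_hat_cases)
    show "\<exists>F\<in>?S'. \<not> incident (face_at (hat M) 0 \<Theta>) F \<and> \<not> incident (face_at (hat M) 0 \<Theta>') F"
    proof (rule ccontr)
      assume "\<not> ?thesis"
      then have cov: "incident (face_at (hat M) 0 \<Theta>) F \<or> incident (face_at (hat M) 0 \<Theta>') F"
        if "F \<in> ?S'" for F using that by blast
      then consider "incident (face_at (hat M) 0 \<Theta>) (hat_facet M zero_vec)"
        | "incident (face_at (hat M) 0 \<Theta>') (hat_facet M zero_vec)" by blast
      then show False
        by cases (use main[of \<Phi> x \<Psi> y] main[of \<Psi> y \<Phi> x] cov * in blast)+
    qed
  qed
qed

lemma vertex_spread_SS: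
  assumes "admissible_S3 S3" "3 \<le> n"
  shows "vertex_spread (MM n) (SS S3 n)"
  using assms(2)
proof (induction n rule: dec_induct)
  case base
  have "SS S3 3 = S3" by (simp add: numeral_3_eq_3)
  moreover have "S3 \<subseteq> facets (MM 3)"
    "\<And>\<Phi> \<Psi>. \<lbrakk>\<Phi> \<in> flags (MM 3); \<Psi> \<in> flags (MM 3)\<rbrakk> \<Longrightarrow>
       \<not> S3 \<subseteq> {G \<in> facets (MM 3). incident (face_at (MM 3) 0 \<Phi>) G} \<union>
              {G \<in> facets (MM 3). incident (face_at (MM 3) 0 \<Psi>) G}"
    using assms(1) by (auto simp: admissible_S3_def faces_def)
  ultimately show ?case unfolding vertex_spread_def by blast
next
  case (step n)
  then interpret flag_polytope "MM n" by (simp add: flag_polytope_MM)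
  show ?case using vertex_spread_hat step by (simp add: MM_Suc)
qed

lemma (in regular_polytope) automorphism_inverse_symmetry:
  assumes "automorphism M \<gamma>"
  shows "symmetry M (inv \<gamma>)"
proof -
  have perm: "\<gamma> permutes flags M" using assms by (simp add: automorphism_def)
  note inv = permutes_inv[OF perm]
  have "inv \<gamma> (adj M i \<Phi>) = adj M i (inv \<gamma> \<Phi>)" if "i < mrank M" "\<Phi> \<in> flags M" for i \<Phi>
  proof -
    have "inv \<gamma> \<Phi> \<in> flags M" using that permutes_in_image[OF inv] by blast
    then have "\<gamma> (adj M i (inv \<gamma> \<Phi>)) = adj M i \<Phi>"
      using assms that permutes_inverses(1)[OF perm] by (simp add: automorphism_def)
    then show ?thesis using permutes_inverses(2)[OF perm] by metis
  qed
  then show ?thesis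
    using permutes_inj_on[OF inv] permutes_image[OF inv] by (auto simp: symmetry_def)
qed

lemma (in regular_polytope) vertex_spread_automorphism:
  assumes "vertex_spread M S" "automorphism M \<gamma>"
  shows "vertex_spread M (set_image \<gamma> S)"
  unfolding vertex_spread_def
proof (intro conjI ballI)
  note sym = automorphism_symmetry[OF assms(2)]
  note isym = automorphism_inverse_symmetry[OF assms(2)]
  have perm: "\<gamma> permutes flags M" using assms by (simp add: automorphism_def)
  show "set_image \<gamma> S \<subseteq> facets M"
  proof
    fix F assume "F \<in> set_image \<gamma> S"
    then obtain F' where F': "F' \<in> facets M" "F = \<gamma> ` F'"
      using assms(1) by (auto simp: set_image_def vertex_spread_def)
    then obtain \<Phi> where "\<Phi> \<in> flags M" "F' = facet_at M \<Phi>" by (blast elim: facets_cases)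
    then show "F \<in> facets M"
      using F' sym symmetry_image_face_at[OF sym] facet_in_facets[of "\<gamma> \<Phi>"]
      by (auto simp: facet_at_def symmetry_def)
  qed
  fix \<Phi> \<Psi> assume *: "\<Phi> \<in> flags M" "\<Psi> \<in> flags M"
  have inc: "incident (face_at M 0 (inv \<gamma> \<Theta>)) F"
    if "\<Theta> \<in> flags M" "incident (face_at M 0 \<Theta>) (\<gamma> ` F)" for \<Theta> F
    using that(2) permutes_inverses(2)[OF perm]
    unfolding incident_def symmetry_image_face_at[OF isym that(1), symmetric]
    by force
  have "inv \<gamma> \<Phi> \<in> flags M" "inv \<gamma> \<Psi> \<in> flags M"
    using * isym by (auto simp: symmetry_def)
  then obtain F where "F \<in> S" "\<not> incident (face_at M 0 (inv \<gamma> \<Phi>)) F"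
    "\<not> incident (face_at M 0 (inv \<gamma> \<Psi>)) F"
    using assms(1) unfolding vertex_spread_def by blast
  then show "\<exists>F\<in>set_image \<gamma> S. \<not> incident (face_at M 0 \<Phi>) F \<and> \<not> incident (face_at M 0 \<Psi>) F"
    using inc * by (auto simp: set_image_def)
qed

section \<open>The permutation rho on facets\<close>

context regular_polytope
begin

lemma flag_induct [consumes 2, case_names base adj]:
  assumes "\<Phi> \<in> flags M" "\<Psi> \<in> flags M" "P \<Phi>"
    and "\<And>\<Theta> i. \<lbrakk>\<Theta> \<in> flags M; i < mrank M; P \<Theta>\<rbrakk> \<Longrightarrow> P (adj M i \<Theta>)"
  shows "P \<Psi>"
proof -
  obtain w where "set w \<subseteq> {..<mrank M}" "\<Psi> = word M w \<Phi>" using connected assms by blast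
  moreover have "set w \<subseteq> {..<mrank M} \<Longrightarrow> P (word M w \<Phi>)" for w
    by (induction w) (auto simp: assms word_flag)
  ultimately show ?thesis by blast
qed

text \<open>
  The flags on the edge of \<open>\<Phi>\<close> are reached by the colors 0, 2, 3, and so on, all of which commute
  with color 0.
\<close>

lemma agrees_with_adj0_on_edge:
  assumes f: "\<And>i \<Phi>. \<lbrakk>i < mrank M; \<Phi> \<in> flags M\<rbrakk> \<Longrightarrow> f (adj M i \<Phi>) = adj M i (f \<Phi>)"
    and "\<Phi> \<in> flags M" "f \<Phi> = adj M 0 \<Phi>" "\<Psi> \<in> face_at M 1 \<Phi>"
  shows "f \<Psi> = adj M 0 \<Psi>"
proof -
  let ?J = "{..<mrank M} - {1}"
  obtain w where w: "set w \<subseteq> ?J" "\<Psi> = word M w \<Phi>"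
    using assms unfolding face_at_def by (subst (asm) component_eq_words) auto
  have "f \<Psi> = word M w (f \<Phi>)"
    using foldr_equivariant[of ?J "flags M" "adj M" f "adj M" w \<Phi>] w f assms(2)
    by (auto simp: adj_flag)
  moreover have "adj M 0 (adj M i \<Theta>) = adj M i (adj M 0 \<Theta>)" if "i \<in> ?J" "\<Theta> \<in> flags M" for i \<Theta>
    using that adj_commute[of \<Theta> 0 i] by (cases "i = 0") auto
  then have "adj M 0 \<Psi> = word M w (adj M 0 \<Phi>)"
    using foldr_equivariant[of ?J "flags M" "adj M" "adj M 0" "adj M" w \<Phi>] w assms(2)
    by (auto simp: adj_flag)
  ultimately show ?thesis using assms(3) by simp
qed

end

definition covered_by_vertices :: "'f maniplex \<Rightarrow> 'f \<Rightarrow> 'f \<Rightarrow> 'f set set \<Rightarrow> bool" where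
  "covered_by_vertices M \<Phi> \<Psi> S \<longleftrightarrow>
     (\<forall>F\<in>S. incident (face_at M 0 \<Phi>) F \<or> incident (face_at M 0 \<Psi>) F)"

locale rho_setting =
  fixes n :: nat and S3 :: "flag set set" and \<Phi>0 :: flag and \<rho> :: "flag \<Rightarrow> flag"
    and M N :: "flag maniplex"
  defines "M \<equiv> MM (n - 1)" and "N \<equiv> MM n"
  assumes n_ge_4: "n \<ge> 4"
    and S3: "admissible_S3 S3"
    and base_flag: "\<Phi>0 \<in> flags M"
    and rho: "is_rho0 n S3 (face_at M 1 \<Phi>0) \<rho>"
begin

lemma N_eq: "N = hat M"
  using MM_Suc[of "n - 1"] n_ge_4 by (simp add: M_def N_def)

lemma mrank_M: "mrank M = n - 1" and mrank_N: "mrank N = n"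
  using mrank_MM n_ge_4 by (simp_all add: M_def N_def)

sublocale M: flag_polytope M
  using flag_polytope_MM[of "n - 1"] n_ge_4 by (simp add: M_def)

sublocale N: flag_polytope N
  using flag_polytope_MM[of n] n_ge_4 by (simp add: N_def)

lemma adj_N_low: "i < n - 1 \<Longrightarrow> adj N i (Hat \<Phi> x) = Hat (adj M i \<Phi>) x"
  using M.adj_hat_low by (simp add: N_eq mrank_M)

lemma adj_N_top: "adj N (n - 1) (Hat \<Phi> x) = Hat \<Phi> (vec_add x (chi (facet_at M \<Phi>)))"
  using M.adj_hat_top by (simp add: N_eq mrank_M)

lemma Hat_in_N: "Hat \<Phi> x \<in> flags N \<longleftrightarrow> \<Phi> \<in> flags M \<and> x \<in> vecs M"
  by (simp add: N_eq M.Hat_in_flags)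

lemma flags_N_cases:
  assumes "\<Theta> \<in> flags N"
  obtains \<Phi> x where "\<Theta> = Hat \<Phi> x" "\<Phi> \<in> flags M" "x \<in> vecs M"
  using assms M.flags_hat_cases by (auto simp: N_eq)

text \<open>
  On the facet with vector \<open>x\<close>, \<open>\<rho>\<close> is given by a map \<open>f\<close> of the flags of \<open>M\<close>. It is an
  involution: \<open>f \<circ> f\<close> commutes with the colors of \<open>M\<close> and fixes the flag \<open>\<Phi>\<close> chosen for this
  facet.
\<close>

lemma rho_on_facet:
  assumes x: "x \<in> vecs M"
  shows "\<exists>f \<Phi>. \<Phi> \<in> flags M \<and> f \<Phi> = adj M 0 \<Phi> \<and>
    face_at N 1 (Hat \<Phi> x) = base_edge n S3 (face_at M 1 \<Phi>0) x \<and>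
    (\<forall>\<Psi>\<in>flags M. f \<Psi> \<in> flags M \<and> \<rho> (Hat \<Psi> x) = Hat (f \<Psi>) x \<and> f (f \<Psi>) = \<Psi> \<and>
      (\<forall>i<n - 1. f (adj M i \<Psi>) = adj M i (f \<Psi>)))"
proof -
  let ?F = "hat_facet M x"
  have F: "?F = {Hat \<Psi> x | \<Psi>. \<Psi> \<in> flags M}" by (rule M.hat_facet_eq[OF x])
  obtain \<Theta> \<alpha> where \<Theta>: "\<Theta> \<in> ?F" "face_at N 1 \<Theta> = base_edge n S3 (face_at M 1 \<Phi>0) x"
    and \<alpha>: "automorphism (facet_maniplex N ?F) \<alpha>" "\<alpha> \<Theta> = adj N 0 \<Theta>" "\<forall>\<Psi>\<in>?F. \<rho> \<Psi> = \<alpha> \<Psi>"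
    using rho x unfolding is_rho0_def Let_def M_def N_def by blast
  obtain \<Phi> where \<Phi>: "\<Theta> = Hat \<Phi> x" "\<Phi> \<in> flags M" using \<Theta>(1) F by auto
  have perm: "\<alpha> permutes ?F"
    and comm: "\<And>i \<Psi>. \<lbrakk>i < n - 1; \<Psi> \<in> ?F\<rbrakk> \<Longrightarrow> \<alpha> (adj N i \<Psi>) = adj N i (\<alpha> \<Psi>)"
    using \<alpha>(1) by (auto simp: automorphism_def facet_maniplex_def mrank_N)
  have "\<exists>\<Psi>'. \<Psi>' \<in> flags M \<and> \<rho> (Hat \<Psi> x) = Hat \<Psi>' x" if "\<Psi> \<in> flags M" for \<Psi>
    using permutes_in_image[OF perm, of "Hat \<Psi> x"] \<alpha>(3) that F by auto
  then obtain f where f: "\<And>\<Psi>. \<Psi> \<in> flags M \<Longrightarrow> f \<Psi> \<in> flags M \<and> \<rho> (Hat \<Psi> x) = Hat (f \<Psi>) x"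
    by metis
  have fadj: "f (adj M i \<Psi>) = adj M i (f \<Psi>)" if "i < n - 1" "\<Psi> \<in> flags M" for i \<Psi>
  proof -
    have "Hat \<Psi> x \<in> ?F" "Hat (adj M i \<Psi>) x \<in> ?F" using that F M.adj_flag mrank_M by auto
    then have "Hat (f (adj M i \<Psi>)) x = Hat (adj M i (f \<Psi>)) x"
      using comm[OF that(1), of "Hat \<Psi> x"] \<alpha>(3) f[OF that(2)] f[of "adj M i \<Psi>"] that
      by (simp add: adj_N_low M.adj_flag mrank_M)
    then show ?thesis by simp
  qed
  have f\<Phi>: "f \<Phi> = adj M 0 \<Phi>"
    using \<alpha>(2,3) \<Theta>(1) f[OF \<Phi>(2)] \<Phi>(1) n_ge_4 by (simp add: adj_N_low)
  have "f (f \<Psi>) = \<Psi>" if "\<Psi> \<in> flags M" for \<Psi>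
    using \<Phi>(2) that
  proof (induction rule: M.flag_induct)
    case base
    then show ?case using f\<Phi> fadj[of 0 \<Phi>] \<Phi> n_ge_4 by (simp add: M.adj_adj mrank_M)
  next
    case (adj \<Theta> i)
    then show ?case using fadj f by (simp add: mrank_M)
  qed
  then show ?thesis using f fadj f\<Phi> \<Phi> \<Theta>(2) by blast
qed

text \<open>
  The sets \<open>S\<^sub>n\<^sub>-\<^sub>1\<gamma>\<close> are not covered by two vertices, so the exceptional case in the choice of
  the base edge does not occur for vectors whose support is covered in this way.
\<close>

lemma base_edge_generic:
  assumes "x \<in> vecs M" "\<Phi> \<in> flags M" "\<Psi> \<in> flags M" "covered_by_vertices M \<Phi> \<Psi> (supp x)"
  shows "base_edge n S3 e x = hat_face M 1 e x"
proof -
  have "vertex_spread M (SS S3 (n - 1))" using vertex_spread_SS[OF S3] n_ge_4 by (simp add: M_def)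
  then have "\<not> (\<exists>\<gamma>. automorphism M \<gamma> \<and> supp x = set_image \<gamma> (SS S3 (n - 1)))"
    using M.vertex_spread_automorphism[of "SS S3 (n - 1)"] assms
    unfolding vertex_spread_def covered_by_vertices_def by metis
  then show ?thesis unfolding base_edge_def Let_def M_def by (simp only: if_False)
qed

text \<open>
  The reflection of \<open>M\<close> that exchanges the ends of the standard base edge, read off the facet with
  vector zero.
\<close>

definition mirror :: "flag \<Rightarrow> flag" where
  "mirror \<Psi> = (THE \<Theta>. \<rho> (Hat \<Psi> zero_vec) = Hat \<Theta> zero_vec)"

text \<open>
  Whenever the base edge is the standard one, \<open>\<rho>\<close> acts on the facet by the same map, because the
  maps of two such facets agree with color 0 at \<open>\<Phi>0\<close> and \<open>M\<close> is connected.
\<close>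

lemma
  shows mirror_flag: "\<Psi> \<in> flags M \<Longrightarrow> mirror \<Psi> \<in> flags M"
    and mirror_mirror: "\<Psi> \<in> flags M \<Longrightarrow> mirror (mirror \<Psi>) = \<Psi>"
    and mirror_adj: "\<lbrakk>i < n - 1; \<Psi> \<in> flags M\<rbrakk> \<Longrightarrow> mirror (adj M i \<Psi>) = adj M i (mirror \<Psi>)"
    and mirror_edge: "\<Psi> \<in> face_at M 1 \<Phi>0 \<Longrightarrow> mirror \<Psi> = adj M 0 \<Psi>"
    and rho_mirror: "\<lbrakk>x \<in> vecs M; \<Phi> \<in> flags M; \<Phi>' \<in> flags M;
      covered_by_vertices M \<Phi> \<Phi>' (supp x); \<Psi> \<in> flags M\<rbrakk> \<Longrightarrow> \<rho> (Hat \<Psi> x) = Hat (mirror \<Psi>) x"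
proof -
  let ?e = "face_at M 1 \<Phi>0"
  have local: "\<exists>f. (\<forall>\<Psi>\<in>flags M. f \<Psi> \<in> flags M \<and> \<rho> (Hat \<Psi> x) = Hat (f \<Psi>) x \<and> f (f \<Psi>) = \<Psi> \<and>
      (\<forall>i<n - 1. f (adj M i \<Psi>) = adj M i (f \<Psi>))) \<and> (\<forall>\<Psi>\<in>?e. f \<Psi> = adj M 0 \<Psi>)"
    if x: "x \<in> vecs M" "\<Phi> \<in> flags M" "\<Phi>' \<in> flags M" "covered_by_vertices M \<Phi> \<Phi>' (supp x)"
    for x \<Phi> \<Phi>'
  proof -
    obtain f \<Psi> where f: "\<forall>\<Psi>\<in>flags M. f \<Psi> \<in> flags M \<and> \<rho> (Hat \<Psi> x) = Hat (f \<Psi>) x \<and>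
        f (f \<Psi>) = \<Psi> \<and> (\<forall>i<n - 1. f (adj M i \<Psi>) = adj M i (f \<Psi>))"
      and \<Psi>: "\<Psi> \<in> flags M" "f \<Psi> = adj M 0 \<Psi>" "face_at N 1 (Hat \<Psi> x) = base_edge n S3 ?e x"
      using rho_on_facet[OF x(1)] by blast
    have "Hat \<Psi> x \<in> hat_face M 1 ?e x"
      using \<Psi>(3) N.self_in_face_at[of "Hat \<Psi> x" 1] base_edge_generic[OF x] by simp
    then have "\<Psi> \<in> ?e" by (auto simp: hat_face_def)
    then obtain w where "set w \<subseteq> {..<mrank M} - {1}" "\<Psi> = word M w \<Phi>0"
      using base_flag unfolding face_at_def by (subst (asm) M.component_eq_words) auto
    then have "face_at M 1 \<Psi> = ?e"
      unfolding face_at_def using M.component_word[OF base_flag] by auto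
    moreover have "f (adj M i \<Theta>) = adj M i (f \<Theta>)" if "i < mrank M" "\<Theta> \<in> flags M" for i \<Theta>
      using f that mrank_M by simp
    ultimately have "f \<Theta> = adj M 0 \<Theta>" if "\<Theta> \<in> ?e" for \<Theta>
      using M.agrees_with_adj0_on_edge[of f \<Psi> \<Theta>] \<Psi> that by blast
    with f show ?thesis by (intro exI[of _ f] conjI) blast+
  qed
  have "covered_by_vertices M \<Phi>0 \<Phi>0 (supp zero_vec)"
    by (simp add: covered_by_vertices_def supp_zero)
  from local[OF zero_in_vecs base_flag base_flag this] obtain mirror' where
    mirror': "\<forall>\<Psi>\<in>flags M. mirror' \<Psi> \<in> flags M \<and> mirror' (mirror' \<Psi>) = \<Psi> \<and>
        (\<forall>i<n - 1. mirror' (adj M i \<Psi>) = adj M i (mirror' \<Psi>))"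
      "\<forall>\<Psi>\<in>?e. mirror' \<Psi> = adj M 0 \<Psi>" by blast
  have mirror'_rho: "\<rho> (Hat \<Psi> x) = Hat (mirror' \<Psi>) x"
    if x: "x \<in> vecs M" "\<Phi> \<in> flags M" "\<Phi>' \<in> flags M" "covered_by_vertices M \<Phi> \<Phi>' (supp x)"
      and \<Psi>: "\<Psi> \<in> flags M" for x \<Phi> \<Phi>' \<Psi>
  proof -
    obtain f where f: "\<forall>\<Psi>\<in>flags M. f \<Psi> \<in> flags M \<and> \<rho> (Hat \<Psi> x) = Hat (f \<Psi>) x \<and> f (f \<Psi>) = \<Psi> \<and>
        (\<forall>i<n - 1. f (adj M i \<Psi>) = adj M i (f \<Psi>))" "\<forall>\<Psi>\<in>?e. f \<Psi> = adj M 0 \<Psi>"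
      using local[OF x] by blast
    from base_flag \<Psi> have "f \<Psi> = mirror' \<Psi>"
    proof (induction rule: M.flag_induct)
      case base
      have "\<Phi>0 \<in> ?e" by (rule M.self_in_face_at)
      then show ?case using f(2) mirror'(2) by simp
    next
      case (adj \<Theta> i)
      then show ?case using f(1) mirror'(1) by (simp add: mrank_M)
    qed
    then show ?thesis using f \<Psi> by simp
  qed
  have eq: "mirror \<Psi> = mirror' \<Psi>" if "\<Psi> \<in> flags M" for \<Psi>
    using mirror'_rho[OF zero_in_vecs base_flag base_flag _ that]
    by (simp add: mirror_def covered_by_vertices_def supp_zero)
  show "mirror \<Psi> \<in> flags M" if "\<Psi> \<in> flags M" for \<Psi> using that eq mirror'(1) by simp
  show "mirror (mirror \<Psi>) = \<Psi>" if "\<Psi> \<in> flags M" for \<Psi> using that eq mirror'(1) by simp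
  show "mirror (adj M i \<Psi>) = adj M i (mirror \<Psi>)" if "i < n - 1" "\<Psi> \<in> flags M" for i \<Psi>
    using that eq mirror'(1) M.adj_flag by (simp add: mrank_M)
  show "mirror \<Psi> = adj M 0 \<Psi>" if "\<Psi> \<in> face_at M 1 \<Phi>0" for \<Psi>
    using that eq[of \<Psi>] mirror'(2) subsetD[OF M.face_at_flags[OF base_flag] that] by simp
  show "\<rho> (Hat \<Psi> x) = Hat (mirror \<Psi>) x" if "x \<in> vecs M" "\<Phi> \<in> flags M" "\<Phi>' \<in> flags M"
    "covered_by_vertices M \<Phi> \<Phi>' (supp x)" "\<Psi> \<in> flags M" for x \<Phi> \<Phi>' \<Psi>
    using mirror'_rho[OF that] eq[OF that(5)] by simp
qed

lemma rho_flag: "\<Theta> \<in> flags N \<Longrightarrow> \<rho> \<Theta> \<in> flags N"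
  using rho permutes_in_image[of \<rho> "flags N" \<Theta>] by (auto simp: is_rho0_def N_def)

lemma rho_adj: 
  assumes "\<Theta> \<in> flags N" "i < n - 1"
  shows "\<rho> (adj N i \<Theta>) = adj N i (\<rho> \<Theta>)"
proof -
  obtain \<Phi> x where *: "\<Theta> = Hat \<Phi> x" "\<Phi> \<in> flags M" "x \<in> vecs M"
    using assms by (elim flags_N_cases)
  then show ?thesis using rho_on_facet[OF *(3)] assms M.adj_flag[OF *(2), of i]
    by (auto simp: adj_N_low mrank_M)
qed

lemma rho_rho:
  assumes "\<Theta> \<in> flags N"
  shows "\<rho> (\<rho> \<Theta>) = \<Theta>"
proof -
  obtain \<Phi> x where *: "\<Theta> = Hat \<Phi> x" "\<Phi> \<in> flags M" "x \<in> vecs M"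
    using assms by (elim flags_N_cases)
  then show ?thesis using rho_on_facet[OF *(3)] by auto
qed

text \<open>
  The letter \<open>n\<close> acts as \<open>\<rho>\<close>, so that the words of all walks of the premaniplex act on flags.
\<close>

definition step :: "nat \<Rightarrow> flag \<Rightarrow> flag" where
  "step i = (if i = n then \<rho> else adj N i)"

lemma step_low: "i < n \<Longrightarrow> step i = adj N i" and step_top: "step n = \<rho>"
  by (simp_all add: step_def)

lemma step_flag: "\<lbrakk>\<Theta> \<in> flags N; i \<le> n\<rbrakk> \<Longrightarrow> step i \<Theta> \<in> flags N"
  by (simp add: step_def rho_flag N.adj_flag mrank_N)

lemma step_step: "\<lbrakk>\<Theta> \<in> flags N; i \<le> n\<rbrakk> \<Longrightarrow> step i (step i \<Theta>) = \<Theta>"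
  by (simp add: step_def rho_rho N.adj_adj mrank_N)

lemma foldr_step_flag: "\<lbrakk>\<Theta> \<in> flags N; set w \<subseteq> {..n}\<rbrakk> \<Longrightarrow> foldr step w \<Theta> \<in> flags N"
  by (induction w) (auto intro: step_flag)

lemma foldr_step_low: "set w \<subseteq> {..<n} \<Longrightarrow> foldr step w = word N w"
  by (induction w) (auto simp: step_def)

section \<open>Walks starting in the zero facet\<close>

text \<open>
  Started at \<open>(\<chi>, 0)\<close>, a word in the colors from 2 to \<open>n\<close> (with \<open>\<rho>\<close> for \<open>n\<close>) stays among the
  facets on which \<open>\<rho>\<close> is \<open>mirror\<close>. Colors 2 to \<open>n - 2\<close> keep the vertex of the \<open>M\<close>-coordinate, and
  \<open>mirror\<close> commutes with them and exchanges the vertex of \<open>\<chi>\<close> with that of \<open>mirror \<chi>\<close>; so every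
  facet that color \<open>n - 1\<close> adds to the vector contains one of these two vertices, and this is the
  condition under which \<open>rho_mirror\<close> applies to the next letter.
\<close>

lemma generic_walk:
  assumes "set w \<subseteq> {2..n}" "\<chi> \<in> flags M"
  shows "\<exists>\<phi> x. foldr step w (Hat \<chi> zero_vec) = Hat \<phi> x \<and> x \<in> vecs M \<and>
    \<phi> \<in> component M {2..<n - 1} (if even (count_list w n) then \<chi> else mirror \<chi>) \<and>
    covered_by_vertices M \<chi> (mirror \<chi>) (supp x)"
  using assms(1)
proof (induction w)
  case Nil
  then show ?case
    by (auto simp: M.self_in_component zero_in_vecs covered_by_vertices_def supp_zero)
next
  case (Cons i w)
  define \<beta> where "\<beta> = (if even (count_list w n) then \<chi> else mirror \<chi>)"
  have \<beta>: "\<beta> \<in> flags M" using assms(2) mirror_flag by (simp add: \<beta>_def)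
  have J: "{2..<n - 1} \<subseteq> {..<mrank M}" by (auto simp: mrank_M)
  from Cons obtain \<phi> x where *: "foldr step w (Hat \<chi> zero_vec) = Hat \<phi> x" "x \<in> vecs M"
    "\<phi> \<in> component M {2..<n - 1} \<beta>" "covered_by_vertices M \<chi> (mirror \<chi>) (supp x)"
    unfolding \<beta>_def by auto
  obtain v where v: "set v \<subseteq> {2..<n - 1}" "\<phi> = word M v \<beta>"
    using *(3) unfolding M.component_eq_words[OF \<beta> J] by blast
  have \<phi>: "\<phi> \<in> flags M" using *(3) M.component_flags[OF \<beta> J] by blast
  consider "i < n - 1" "2 \<le> i" | "i = n - 1" "2 \<le> i" | "i = n" using Cons.prems by force
  then show ?case
  proof cases
    case 1
    then have "adj M i \<phi> = word M (i # v) \<beta>" "set (i # v) \<subseteq> {2..<n - 1}" using v by auto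
    then have "adj M i \<phi> \<in> component M {2..<n - 1} \<beta>"
      unfolding M.component_eq_words[OF \<beta> J] by blast
    then show ?thesis using 1 * by (auto simp: step_low adj_N_low \<beta>_def)
  next
    case 2
    have "face_at M 0 \<phi> = face_at M 0 \<beta>"
      using v J unfolding face_at_def by (simp, intro M.component_word[OF \<beta>]) auto
    then have "incident (face_at M 0 \<beta>) (facet_at M \<phi>)"
      using M.face_at_incident_facet_at by metis
    then have "incident (face_at M 0 \<chi>) (facet_at M \<phi>) \<or> incident (face_at M 0 (mirror \<chi>)) (facet_at M \<phi>)"
      by (auto simp: \<beta>_def split: if_splits)
    moreover have "facet_at M \<phi> \<in> facets M" using \<phi> by (rule M.facet_in_facets)
    ultimately have "covered_by_vertices M \<chi> (mirror \<chi>) (supp (vec_add x (chi (facet_at M \<phi>))))"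
      "vec_add x (chi (facet_at M \<phi>)) \<in> vecs M"
      using * by (auto simp: covered_by_vertices_def supp_vec_add M.supp_chi_facet
          intro!: vecs_add M.chi_in_vecs)
    then show ?thesis using 2 * n_ge_4 by (auto simp: step_low adj_N_top[simplified] \<beta>_def)
  next
    case 3
    have "mirror \<phi> = word M v (mirror \<beta>)"
      using foldr_equivariant[of "{2..<n - 1}" "flags M" "adj M" mirror "adj M" v \<beta>] v \<beta>
      by (auto simp: M.adj_flag mrank_M mirror_adj)
    then have "mirror \<phi> \<in> component M {2..<n - 1} (mirror \<beta>)"
      using v unfolding M.component_eq_words[OF mirror_flag[OF \<beta>] J] by blast
    moreover have "\<rho> (Hat \<phi> x) = Hat (mirror \<phi>) x"
      using rho_mirror[OF *(2) assms(2) mirror_flag[OF assms(2)] *(4) \<phi>] .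
    ultimately show ?thesis using 3 * assms(2) by (auto simp: step_top \<beta>_def mirror_mirror)
  qed
qed

text \<open>
  At flags on the base edge \<open>mirror\<close> is color 0, and such a walk never leaves this edge.
\<close>

lemma generic_walk_edge:
  assumes "set w \<subseteq> {2..n}" "\<chi> \<in> face_at M 1 \<Phi>0"
  shows "foldr step w (Hat \<chi> zero_vec) =
    word N (map (\<lambda>i. if i = n then 0 else i) w) (Hat \<chi> zero_vec)"
  using assms(1)
proof (induction w)
  case (Cons i w)
  have \<chi>: "\<chi> \<in> flags M" using assms(2) M.face_at_flags[OF base_flag] by blast
  have J: "{2..<n - 1} \<subseteq> {..<mrank M}" "{2..<n - 1} \<subseteq> {..<mrank M} - {1}" by (auto simp: mrank_M)
  have e: "face_at M 1 \<chi> = face_at M 1 \<Phi>0"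
    using assms(2) base_flag M.component_word[OF base_flag, of "{..<mrank M} - {1}"]
    unfolding face_at_def by (subst (asm) M.component_eq_words) auto
  obtain \<phi> x where *: "foldr step w (Hat \<chi> zero_vec) = Hat \<phi> x" "x \<in> vecs M"
    "\<phi> \<in> component M {2..<n - 1} (if even (count_list w n) then \<chi> else mirror \<chi>)"
    "covered_by_vertices M \<chi> (mirror \<chi>) (supp x)"
    using generic_walk[OF _ \<chi>, of w] Cons.prems by auto
  let ?\<beta> = "if even (count_list w n) then \<chi> else mirror \<chi>"
  have \<beta>: "?\<beta> \<in> flags M" "face_at M 1 ?\<beta> = face_at M 1 \<Phi>0"
    using \<chi> mirror_flag[OF \<chi>] mirror_edge[OF assms(2)] M.face_at_adj[OF \<chi>, of 0 1] e mrank_M n_ge_4 by auto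
  obtain v where v: "set v \<subseteq> {2..<n - 1}" "\<phi> = word M v ?\<beta>"
    using *(3) unfolding M.component_eq_words[OF \<beta>(1) J(1)] by blast
  have \<phi>: "\<phi> \<in> flags M" using *(3) M.component_flags[OF \<beta>(1) J(1)] by blast
  have "face_at M 1 \<phi> = face_at M 1 ?\<beta>"
    unfolding face_at_def v(2) using v J by (intro M.component_word[OF \<beta>(1)]) auto
  then have "\<phi> \<in> face_at M 1 \<Phi>0" using \<beta>(2) M.self_in_face_at by metis
  then have "\<rho> (Hat \<phi> x) = adj N 0 (Hat \<phi> x)"
    using rho_mirror[OF *(2) \<chi> mirror_flag[OF \<chi>] *(4) \<phi>] mirror_edge n_ge_4 by (simp add: adj_N_low)
  then show ?case using Cons * by (auto simp: step_low step_top)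
qed simp

end

section \<open>Walks and voltages on a premaniplex with two vertices\<close>

definition neighbour :: "nat set \<Rightarrow> nat \<Rightarrow> vertex \<Rightarrow> vertex" where
  "neighbour I i v = (if i \<in> I then v else other v)"

lemma other_other [simp]: "other (other v) = v"
  by (cases v) auto

lemma neighbour_neighbour [simp]: "neighbour I i (neighbour I i v) = v"
  by (simp add: neighbour_def)

lemma neighbour_other: "neighbour I i (other v) = other (neighbour I i v)"
  by (simp add: neighbour_def)

lemma two_premaniplex_simps [simp]:
  "verts (two_premaniplex n I) = UNIV"
  "(v, i) \<in> darts (two_premaniplex n I) \<longleftrightarrow> i \<le> n"
  "src (two_premaniplex n I) (v, i) = v"
  "rev_dart (two_premaniplex n I) (v, i) = (neighbour I i v, i)"
  "col (two_premaniplex n I) (v, i) = i"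
  "tgt (two_premaniplex n I) (v, i) = neighbour I i v"
  by (auto simp: two_premaniplex_def tgt_def neighbour_def)

fun lift_word :: "nat set \<Rightarrow> vertex \<Rightarrow> nat list \<Rightarrow> (vertex \<times> nat) list" where
  "lift_word I a [] = []"
| "lift_word I a (i # w) = (a, i) # lift_word I (neighbour I i a) w"

lemma walk_lift_word:
  "\<lbrakk>set w \<subseteq> {..n}; foldr (neighbour I) w b = a\<rbrakk> \<Longrightarrow> walk (two_premaniplex n I) a b (lift_word I a w)"
  by (induction w arbitrary: a) auto

lemma colors_lift_word: "map snd (lift_word I a w) = w"
  by (induction w arbitrary: a) auto

lemma walk_colors: "walk (two_premaniplex n I) a b w \<Longrightarrow> snd ` set w \<subseteq> {..n}"
  by (induction w arbitrary: a) auto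

lemma walk_end: "walk (two_premaniplex n I) a b w \<Longrightarrow> foldr (neighbour I) (map snd w) b = a"
  by (induction w arbitrary: a) auto

lemma walk_voltage_append:
  "walk_voltage \<xi> (u @ v) P = walk_voltage \<xi> u (walk_voltage \<xi> v P)"
  by (induction u) (auto simp: fcomp_def)

lemma walk_dart: "walk X a b (u @ d # v) \<Longrightarrow> d \<in> darts X"
  by (induction u arbitrary: a) auto

text \<open>
  An elementary homotopy inserts a dart and its inverse, whose voltages cancel.
\<close>

lemma path_voltage_class:
  assumes "\<And>d. d \<in> darts X \<Longrightarrow> \<xi> (rev_dart X d) \<circ>> \<xi> d = id"
  shows "path_voltage \<xi> (homotopy X a b `` {w}) = walk_voltage \<xi> w"
proof -
  have elem: "walk_voltage \<xi> x = walk_voltage \<xi> y" if xy: "(x, y) \<in> elem_homotopy X a b" for x y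
  proof -
    obtain u v d where *: "x = u @ v" "y = u @ d # rev_dart X d # v"
        "walk X a b (u @ d # rev_dart X d # v)"
      using xy by (auto simp: elem_homotopy_def)
    have "d \<in> darts X" using *(3) by (rule walk_dart)
    then have "\<xi> (rev_dart X d) \<circ>> \<xi> d = id" by (rule assms)
    then have "\<xi> d (\<xi> (rev_dart X d) P) = P" for P by (metis fcomp_apply id_apply)
    then show ?thesis unfolding *(1,2) by (intro ext) (simp add: walk_voltage_append)
  qed
  have "walk_voltage \<xi> y = walk_voltage \<xi> w" if "(w, y) \<in> homotopy X a b" for y
    using that unfolding homotopy_def
  proof (induction rule: rtrancl_induct)
    case (step y z)
    from step.hyps(2) have "walk_voltage \<xi> y = walk_voltage \<xi> z"
    proof
      assume "(y, z) \<in> elem_homotopy X a b"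
      then show ?thesis by (rule elem)
    next
      assume "(y, z) \<in> (elem_homotopy X a b)\<inverse>"
      then show ?thesis by (intro elem[symmetric]) simp
    qed
    then show ?case using step.IH by simp
  qed simp
  then have "walk_voltage \<xi> ` (homotopy X a b `` {w}) = (\<lambda>_. walk_voltage \<xi> w) ` (homotopy X a b `` {w})"
    by (intro image_cong refl) blast
  also have "\<dots> = {walk_voltage \<xi> w}"
    by (rule image_constant[of w]) (simp add: homotopy_def)
  finally show ?thesis by (simp add: path_voltage_def)
qed

lemma path_voltage_paths:
  assumes "\<And>d. d \<in> darts X \<Longrightarrow> \<xi> (rev_dart X d) \<circ>> \<xi> d = id"
  shows "path_voltage \<xi> ` paths X J a b =
    {walk_voltage \<xi> w | w. walk X a b w \<and> col X ` set w \<subseteq> J}"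
proof -
  have "path_voltage \<xi> (homotopy X a b `` {w}) = walk_voltage \<xi> w" for w
    using assms by (rule path_voltage_class)
  then have "path_voltage \<xi> ` paths X J a b =
      walk_voltage \<xi> ` {w. walk X a b w \<and> col X ` set w \<subseteq> J}"
    unfolding paths_def setcompr_eq_image image_image by simp
  then show ?thesis by (simp add: setcompr_eq_image)
qed

section \<open>The voltage assignment acts by words\<close>

locale voltage_setting = rho_setting +
  fixes I :: "nat set" and p :: "flag \<Rightarrow> vertex" and l :: nat
    and s :: "flag \<times> nat \<Rightarrow> flag \<times> nat"
  assumes zero_I: "0 \<notin> I" and n_I: "n \<notin> I"
    and cover: "covering N (delete_color n (two_premaniplex n I)) p"
    and l_pos: "l > 0"
    and s_perm: "s permutes white_points n p l"
    and s_inv: "s \<circ>> s = id"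
    and s_fst: "\<And>\<Psi> c. fst (s (\<Psi>, c)) = \<Psi>"
    and s_comm: "s \<circ>> white_action n p l (\<rho> \<circ>> adj N 0) = white_action n p l (\<rho> \<circ>> adj N 0) \<circ>> s"
begin

lemma p_adj: "\<lbrakk>\<Theta> \<in> flags N; i < n\<rbrakk> \<Longrightarrow> p (adj N i \<Theta>) = neighbour I i (p \<Theta>)"
  using cover unfolding covering_def mrank_N
  by (force simp: delete_color_def tgt_def two_premaniplex_def neighbour_def)

lemma neighbour_0 [simp]: "neighbour I 0 = other" and neighbour_n [simp]: "neighbour I n = other"
  using zero_I n_I by (auto simp: neighbour_def)

text \<open>
  Each facet contains a flag at which \<open>\<rho>\<close> is color 0, and as \<open>\<rho>\<close> commutes with the colors of the
  facet, connectedness propagates the claim from this flag.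
\<close>

lemma p_rho:
  assumes "\<Theta> \<in> flags N"
  shows "p (\<rho> \<Theta>) = other (p \<Theta>)"
proof -
  obtain \<Psi> x where *: "\<Theta> = Hat \<Psi> x" "\<Psi> \<in> flags M" "x \<in> vecs M"
    using assms by (elim flags_N_cases)
  obtain f \<Phi> where \<Phi>: "\<Phi> \<in> flags M" "f \<Phi> = adj M 0 \<Phi>"
    and f: "\<forall>\<Psi>\<in>flags M. f \<Psi> \<in> flags M \<and> \<rho> (Hat \<Psi> x) = Hat (f \<Psi>) x \<and> f (f \<Psi>) = \<Psi> \<and>
      (\<forall>i<n - 1. f (adj M i \<Psi>) = adj M i (f \<Psi>))"
    using rho_on_facet[OF *(3)] by blast
  have p_low: "p (Hat (adj M i \<Psi>) x) = neighbour I i (p (Hat \<Psi> x))" if "\<Psi> \<in> flags M" "i < n - 1" for i \<Psi>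
    using that *(3) p_adj[of "Hat \<Psi> x" i] by (simp add: Hat_in_N adj_N_low)
  from \<Phi>(1) *(2) have "p (Hat (f \<Psi>) x) = other (p (Hat \<Psi> x))"
  proof (induction rule: M.flag_induct)
    case base
    then show ?case using \<Phi> p_low[of \<Phi> 0] n_ge_4 by simp
  next
    case (adj \<Theta> i)
    then show ?case using f p_low by (simp add: mrank_M neighbour_other)
  qed
  then show ?thesis using f * by simp
qed

lemma p_step: "\<lbrakk>\<Theta> \<in> flags N; i \<le> n\<rbrakk> \<Longrightarrow> p (step i \<Theta>) = neighbour I i (p \<Theta>)"
  using p_adj p_rho by (cases "i = n") (auto simp: step_low step_top)

lemma p_foldr_step: "\<lbrakk>\<Theta> \<in> flags N; set w \<subseteq> {..n}\<rbrakk> \<Longrightarrow> p (foldr step w \<Theta>) = foldr (neighbour I) w (p \<Theta>)"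
  by (induction w) (auto simp: p_step foldr_step_flag)

text \<open>
  The involution exchanging the flags of color \<open>v\<close> with the white flags that represent them, which
  for black \<open>v\<close> are their 0-neighbors.
\<close>

definition whiten :: "vertex \<Rightarrow> flag \<Rightarrow> flag" where
  "whiten v \<Theta> = (case v of White \<Rightarrow> \<Theta> | Black \<Rightarrow> adj N 0 \<Theta>)"

lemma whiten_flag: "\<Theta> \<in> flags N \<Longrightarrow> whiten v \<Theta> \<in> flags N"
  using n_ge_4 by (cases v) (auto simp: whiten_def N.adj_flag mrank_N)

lemma whiten_whiten: "\<Theta> \<in> flags N \<Longrightarrow> whiten v (whiten v \<Theta>) = \<Theta>"
  using n_ge_4 by (cases v) (auto simp: whiten_def N.adj_adj mrank_N)

lemma p_whiten: "\<Theta> \<in> flags N \<Longrightarrow> p \<Theta> = v \<Longrightarrow> p (whiten v \<Theta>) = White"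
  using n_ge_4 by (cases v) (auto simp: whiten_def p_adj)

lemma p_unwhiten: "\<Theta> \<in> flags N \<Longrightarrow> p \<Theta> = White \<Longrightarrow> p (whiten v \<Theta>) = v"
  using n_ge_4 by (cases v) (auto simp: whiten_def p_adj)

abbreviation "\<xi> \<equiv> xi n I p l \<rho> s"
abbreviation "W \<equiv> white_points n p l"

lemma W_iff: "(\<Psi>, c) \<in> W \<longleftrightarrow> \<Psi> \<in> flags N \<and> p \<Psi> = White \<and> c < 2 * l"
  by (auto simp: white_points_def white_flags_def N_def)

lemma s_W: "P \<in> W \<Longrightarrow> s P \<in> W" and s_fix: "P \<notin> W \<Longrightarrow> s P = P"
  using permutes_in_image[OF s_perm] permutes_not_in[OF s_perm] by auto

lemma xi_fix: "P \<notin> W \<Longrightarrow> \<xi> d P = P"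
  by (cases d; cases P)
    (auto simp: xi_def Let_def y_tilde_def white_action_def fcomp_def s_fix split: if_splits)

text \<open>
  The case distinction in the definition of the voltages is a change of coordinates: with white
  flags representing the flags of the color of the vertex, the dart of color \<open>i\<close> acts by \<open>step i\<close>.
  For \<open>i = n\<close> this uses that \<open>\<rho>\<close> commutes with color 0.
\<close>

lemma xi_formula:
  fixes v :: vertex
  assumes "(\<Psi>, c) \<in> W" "i \<le> n"
  defines "\<Psi>' \<equiv> whiten v (step i (whiten (neighbour I i v) \<Psi>))"
  shows "fst (\<xi> (v, i) (\<Psi>, c)) = \<Psi>'" and "i \<noteq> n \<Longrightarrow> snd (\<xi> (v, i) (\<Psi>, c)) = c"
    and "\<xi> (v, i) (\<Psi>, c) \<in> W"
proof -
  have \<Psi>: "\<Psi> \<in> flags N" "p \<Psi> = White" "c < 2 * l" using assms by (auto simp: W_iff)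
  have 1: "i = 0 \<Longrightarrow> \<xi> (v, i) (\<Psi>, c) = (\<Psi>', c)"
    using n_ge_4 \<Psi> by (cases v)
      (auto simp: xi_def \<Psi>'_def whiten_def step_low N.adj_adj mrank_N)
  have 2: "\<xi> (v, i) (\<Psi>, c) = (\<Psi>', c)" if "i \<noteq> 0" "i \<noteq> n"
    using that assms(1,2)
    by (cases v) (auto simp: xi_def Let_def white_action_def \<Psi>'_def whiten_def step_low
        N_def[symmetric] neighbour_def fcomp_def)
  have 3: "\<xi> (v, n) (\<Psi>, c) = s (\<Psi>', c)" if "i = n"
    using that assms(1) n_ge_4 \<Psi>(1) rho_adj[of \<Psi> 0]
    by (cases v) (auto simp: xi_def Let_def white_action_def y_tilde_def \<Psi>'_def whiten_def
        step_top N_def[symmetric] fcomp_def)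
  have "\<Psi>' \<in> flags N" "p \<Psi>' = White"
    using \<Psi> assms(2) by (simp_all add: \<Psi>'_def whiten_flag step_flag p_step p_whiten p_unwhiten)
  then have W': "(\<Psi>', c) \<in> W" using \<Psi> by (simp add: W_iff)
  show "fst (\<xi> (v, i) (\<Psi>, c)) = \<Psi>'" using 1 2 3 s_fst by (cases "i = 0"; cases "i = n") auto
  show "\<xi> (v, i) (\<Psi>, c) \<in> W" using 1 2 3 s_W[OF W'] W' by (cases "i = 0"; cases "i = n") auto
  show "i \<noteq> n \<Longrightarrow> snd (\<xi> (v, i) (\<Psi>, c)) = c" using 1 2 by (cases "i = 0") auto
qed

lemma y_tilde_involution: "y_tilde n p l \<rho> s \<circ>> y_tilde n p l \<rho> s = id"
proof
  fix P :: "flag \<times> nat"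
  let ?A = "white_action n p l (\<rho> \<circ>> adj N 0)"
  have ss: "s (s P) = P" for P using s_inv by (metis fcomp_apply id_apply)
  have As: "?A (s P) = s (?A P)" for P using s_comm by (metis fcomp_apply)
  have "?A (?A P) = P" for P
  proof (cases P)
    case (Pair \<Psi> c)
    show ?thesis
    proof (cases "P \<in> W")
      case True
      then have \<Psi>: "\<Psi> \<in> flags N" "p \<Psi> = White" "c < 2 * l" by (auto simp: W_iff Pair)
      have "adj N 0 (\<rho> (adj N 0 (\<rho> \<Psi>))) = \<Psi>"
        using \<Psi> n_ge_4 by (simp add: rho_adj rho_flag rho_rho N.adj_adj mrank_N)
      moreover have "(adj N 0 (\<rho> \<Psi>), c) \<in> W"
        using \<Psi> n_ge_4 by (simp add: W_iff N.adj_flag mrank_N rho_flag p_adj p_rho)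
      ultimately show ?thesis using True by (simp add: Pair white_action_def)
    qed (simp add: Pair white_action_def)
  qed
  then show "(y_tilde n p l \<rho> s \<circ>> y_tilde n p l \<rho> s) P = id P"
    unfolding y_tilde_def N_def[symmetric] by (simp add: As ss)
qed

lemma xi_inverse:
  assumes "i \<le> n"
  shows "\<xi> (neighbour I i v, i) \<circ>> \<xi> (v, i) = id"
proof (cases "i = n")
  case True
  then show ?thesis using y_tilde_involution n_ge_4 by (simp add: xi_def)
next
  case False
  show ?thesis
  proof
    fix P :: "flag \<times> nat"
    obtain \<Psi> c where P: "P = (\<Psi>, c)" by (cases P)
    show "(\<xi> (neighbour I i v, i) \<circ>> \<xi> (v, i)) P = id P"
    proof (cases "P \<in> W")
      case True
      let ?Q = "\<xi> (neighbour I i v, i) P"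
      let ?\<Psi>' = "whiten (neighbour I i v) (step i (whiten v \<Psi>))"
      have \<Psi>: "\<Psi> \<in> flags N" using True P by (simp add: W_iff)
      have Q: "?Q = (?\<Psi>', c)" "?Q \<in> W"
        using xi_formula[of \<Psi> c i "neighbour I i v"] True P assms False by (auto intro: prod_eqI)
      have "\<xi> (v, i) ?Q = (\<Psi>, c)"
        using xi_formula[of ?\<Psi>' c i v] Q assms False \<Psi>
        by (auto intro!: prod_eqI simp: whiten_whiten step_flag whiten_flag step_step)
      then show ?thesis by (simp add: P)
    qed (simp add: xi_fix)
  qed
qed

lemma walk_voltage_fix: "P \<notin> W \<Longrightarrow> walk_voltage \<xi> w P = P"
  by (induction w) (auto simp: xi_fix)

text \<open>
  The changes of coordinates of consecutive darts cancel, because the target of a dart is the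
  source of the next one.
\<close>

lemma walk_voltage_formula:
  assumes "walk (two_premaniplex n I) a b w" "(\<Psi>, c) \<in> W"
  shows "fst (walk_voltage \<xi> w (\<Psi>, c)) = whiten a (foldr step (map snd w) (whiten b \<Psi>)) \<and>
    walk_voltage \<xi> w (\<Psi>, c) \<in> W \<and>
    (n \<notin> snd ` set w \<longrightarrow> snd (walk_voltage \<xi> w (\<Psi>, c)) = c)"
  using assms(1)
proof (induction w arbitrary: a)
  case Nil
  then show ?case using assms(2) by (simp add: W_iff whiten_whiten)
next
  case (Cons d w)
  obtain v i where d: "d = (v, i)" by (cases d)
  have *: "v = a" "i \<le> n" and w: "walk (two_premaniplex n I) (neighbour I i a) b w"
    using Cons.prems by (auto simp: d)
  obtain \<Psi>' c' where Q: "walk_voltage \<xi> w (\<Psi>, c) = (\<Psi>', c')" by (cases "walk_voltage \<xi> w (\<Psi>, c)")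
  let ?\<Theta> = "foldr step (map snd w) (whiten b \<Psi>)"
  have \<Theta>: "?\<Theta> \<in> flags N"
    using assms(2) walk_colors[OF w] by (intro foldr_step_flag) (auto simp: W_iff whiten_flag)
  from Cons.IH[OF w] Q have IH: "\<Psi>' = whiten (neighbour I i a) ?\<Theta>" "(\<Psi>', c') \<in> W"
    "n \<notin> snd ` set w \<longrightarrow> c' = c" by auto
  show ?case using xi_formula[OF IH(2) *(2), of a] IH(1,3) \<Theta>
    by (auto simp: d *(1) Q whiten_whiten)
qed

text \<open>
  Without color \<open>n\<close> the second coordinate is untouched, so the voltage is determined by the action
  on flags.
\<close>

lemma walk_voltage_eqI:
  assumes "walk (two_premaniplex n I) a b u" "walk (two_premaniplex n I) a b v"
    and "n \<notin> snd ` set u" "n \<notin> snd ` set v"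
    and "\<And>\<Theta>. \<Theta> \<in> flags N \<Longrightarrow> word N (map snd u) \<Theta> = word N (map snd v) \<Theta>"
  shows "walk_voltage \<xi> u = walk_voltage \<xi> v"
proof
  fix P :: "flag \<times> nat"
  obtain \<Psi> c where P: "P = (\<Psi>, c)" by (cases P)
  show "walk_voltage \<xi> u P = walk_voltage \<xi> v P"
  proof (cases "P \<in> W")
    case True
    have low: "set (map snd w) \<subseteq> {..<n}"
      if "walk (two_premaniplex n I) a b w" "n \<notin> snd ` set w" for w
    proof
      fix i assume i: "i \<in> set (map snd w)"
      then have "i \<le> n" using walk_colors[OF that(1)] by auto
      moreover have "i \<noteq> n" using i that(2) by auto
      ultimately show "i \<in> {..<n}" by simp
    qed
    have "foldr step (map snd u) (whiten b \<Psi>) = foldr step (map snd v) (whiten b \<Psi>)"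
      unfolding foldr_step_low[OF low[OF assms(1,3)]] foldr_step_low[OF low[OF assms(2,4)]]
      using assms(5) True P by (simp add: W_iff whiten_flag)
    moreover have W: "(\<Psi>, c) \<in> W" using True P by simp
    ultimately show ?thesis
      using walk_voltage_formula[OF assms(1) W] walk_voltage_formula[OF assms(2) W] assms(3,4)
      unfolding P by (intro prod_eqI) simp_all
  qed (simp add: walk_voltage_fix)
qed

lemma walk_voltage_eqD:
  assumes "walk (two_premaniplex n I) a b u" "walk (two_premaniplex n I) a b v"
    and "walk_voltage \<xi> u = walk_voltage \<xi> v" and \<Theta>: "\<Theta> \<in> flags N" "p \<Theta> = b"
  shows "foldr step (map snd u) \<Theta> = foldr step (map snd v) \<Theta>"
proof -
  have W: "(whiten b \<Theta>, 0) \<in> W" using \<Theta> l_pos by (simp add: W_iff whiten_flag p_whiten)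
  have flag: "foldr step (map snd w) \<Theta> \<in> flags N" if "walk (two_premaniplex n I) a b w" for w
    using walk_colors[OF that] \<Theta> by (intro foldr_step_flag) auto
  have "whiten a (foldr step (map snd u) \<Theta>) = whiten a (foldr step (map snd v) \<Theta>)"
    using walk_voltage_formula[OF assms(1) W] walk_voltage_formula[OF assms(2) W] assms(3) \<Theta>
    by (simp add: whiten_whiten)
  then show ?thesis using flag assms(1,2) whiten_whiten by metis
qed

section \<open>Eliminating rho\<close>

lemma edge_of_word:
  "\<lbrakk>\<Theta> \<in> flags N; set w \<subseteq> {..<n} - {1}\<rbrakk> \<Longrightarrow> edge_of (word N w \<Theta>) = edge_of \<Theta>"
proof (induction w)
  case (Cons i w)
  then have "word N w \<Theta> \<in> flags N" using N.word_flag[of \<Theta> w] by (auto simp: mrank_N)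
  then show ?case using Cons edge_of_adj_MM[of n "word N w \<Theta>" i] n_ge_4 by (auto simp: N_def)
qed simp

lemma edge_of_component:
  assumes "\<chi> \<in> flags M" "\<phi> \<in> component M {2..<n - 1} \<chi>"
  shows "edge_of \<phi> = edge_of \<chi>"
proof -
  have J: "{2..<n - 1} \<subseteq> {..<mrank M}" by (auto simp: mrank_M)
  then obtain w where w: "set w \<subseteq> {2..<n - 1}" "\<phi> = word M w \<chi>"
    using assms(2) unfolding M.component_eq_words[OF assms(1) J] by blast
  have "set w \<subseteq> {2..<n - 1} \<Longrightarrow> edge_of (word M w \<chi>) = edge_of \<chi>" for w
  proof (induction w)
    case (Cons i w)
    then have "word M w \<chi> \<in> flags M" using M.word_flag[OF assms(1), of w] J by auto
    then show ?case using Cons edge_of_adj_MM[of "n - 1" "word M w \<chi>" i] n_ge_4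
      by (auto simp: M_def)
  qed simp
  with w show ?thesis by blast
qed

text \<open>
  Used with 0-adjacent flags, to find a flag of prescribed color on a given edge.
\<close>

lemma flag_of_color:
  assumes "p (Hat \<chi>' zero_vec) = other (p (Hat \<chi> zero_vec))"
  shows "\<exists>\<psi>\<in>{\<chi>, \<chi>'}. p (Hat \<psi> zero_vec) = b"
  using assms by (cases b; cases "p (Hat \<chi> zero_vec)") auto

lemma word_remove_zeros:
  assumes "\<Theta> \<in> flags N" "set w \<subseteq> {2..n}" "even (count_list w n)"
  shows "word N (map (\<lambda>i. if i = n then 0 else i) w) \<Theta> = word N (filter (\<lambda>i. i \<noteq> n) w) \<Theta>"
proof -
  let ?u = "\<lambda>w. word N (map (\<lambda>i. if i = n then 0 else i) w) \<Theta>"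
  let ?v = "\<lambda>w. word N (filter (\<lambda>i. i \<noteq> n) w) \<Theta>"
  have "set w \<subseteq> {2..n} \<Longrightarrow> ?v w \<in> flags N \<and>
      ?u w = (if even (count_list w n) then ?v w else adj N 0 (?v w))"
  proof (induction w)
    case Nil
    then show ?case using assms by simp
  next
    case (Cons i w)
    then have "?v w \<in> flags N" "2 \<le> i" by auto
    then show ?case using Cons n_ge_4 N.adj_commute[of "?v w" 0 i]
      by (auto simp: N.adj_flag N.adj_adj mrank_N)
  qed
  then show ?thesis using assms by simp
qed

text \<open>
  Let \<open>v0\<close> be \<open>v\<close> with \<open>\<rho>\<close> replaced by color 0. On the base edge \<open>v\<close> acts as \<open>v0\<close>, so \<open>u\<close> and \<open>v0\<close>
  agree at one flag and hence everywhere. Now take a flag on an edge next to the base edge in a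
  common 2-face. There \<open>v0\<close>, which lacks color 1, keeps the edge of the core square, whereas each
  \<open>\<rho>\<close> in \<open>v\<close> carries this edge to the opposite one. So the number of letters \<open>\<rho>\<close> is even, and as
  color 0 commutes with all other letters of \<open>v0\<close>, its occurrences cancel.
\<close>

lemma rho_free_replacement:
  assumes u: "set u \<subseteq> {..<n}" and v: "set v \<subseteq> {2..n}"
    and eq: "\<And>\<Theta>. \<Theta> \<in> flags N \<Longrightarrow> p \<Theta> = b \<Longrightarrow> word N u \<Theta> = foldr step v \<Theta>"
    and "\<Theta> \<in> flags N"
  shows "word N u \<Theta> = word N (filter (\<lambda>i. i \<noteq> n) v) \<Theta>"
proof -
  let ?v0 = "map (\<lambda>i. if i = n then 0 else i) v"
  let ?e = "face_at M 1 \<Phi>0"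
  have v0: "set ?v0 \<subseteq> {..<n} - {1}" using v n_ge_4 by force
  let ?\<Phi>1 = "adj M 0 \<Phi>0"
  have \<Phi>1: "?\<Phi>1 \<in> flags M" using base_flag n_ge_4 by (simp add: M.adj_flag mrank_M)
  have edges: "\<psi> \<in> ?e" if "\<psi> \<in> {\<Phi>0, ?\<Phi>1}" for \<psi>
    using that M.self_in_face_at[of \<psi> 1] M.face_at_adj[OF base_flag, of 0 1] n_ge_4
    by (auto simp: mrank_M)
  have p_low: "p (Hat (adj M i \<psi>) zero_vec) = neighbour I i (p (Hat \<psi> zero_vec))"
    if "\<psi> \<in> flags M" "i < n - 1" for i \<psi>
    using that p_adj[of "Hat \<psi> zero_vec" i] by (simp add: Hat_in_N adj_N_low zero_in_vecs)
  obtain \<psi> where \<psi>: "\<psi> \<in> {\<Phi>0, ?\<Phi>1}" "p (Hat \<psi> zero_vec) = b"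
    using flag_of_color[of ?\<Phi>1 \<Phi>0 b] p_low[OF base_flag, of 0] n_ge_4 by auto
  have \<psi>_flag: "Hat \<psi> zero_vec \<in> flags N"
    using \<psi>(1) base_flag \<Phi>1 by (auto simp: Hat_in_N zero_in_vecs)
  have "word N u (Hat \<psi> zero_vec) = word N ?v0 (Hat \<psi> zero_vec)"
    using eq[OF \<psi>_flag \<psi>(2)] generic_walk_edge[OF v edges[OF \<psi>(1)]] by simp
  then have transfer: "word N u \<Theta> = word N ?v0 \<Theta>" if "\<Theta> \<in> flags N" for \<Theta>
    using N.word_eq_transfer[of u "Hat \<psi> zero_vec" ?v0 \<Theta>] u v0 \<psi>_flag that
    by (auto simp: mrank_N)
  \<comment> \<open>The parity is read off at a flag on an edge adjacent to the base edge.\<close>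
  have "even (count_list v n)"
  proof (rule ccontr)
    assume odd: "odd (count_list v n)"
    let ?\<chi> = "\<lambda>\<psi>. adj M 1 \<psi>"
    have \<chi>: "?\<chi> \<Phi>0 \<in> flags M" "?\<chi> ?\<Phi>1 \<in> flags M"
      using base_flag \<Phi>1 n_ge_4 by (simp_all add: M.adj_flag mrank_M)
    have "p (Hat (?\<chi> ?\<Phi>1) zero_vec) = other (p (Hat (?\<chi> \<Phi>0) zero_vec))"
      using p_low[OF base_flag, of 0] p_low[OF base_flag, of 1] p_low[OF \<Phi>1, of 1] n_ge_4
      by (simp add: neighbour_other)
    then obtain \<psi> where \<psi>: "\<psi> \<in> {\<Phi>0, ?\<Phi>1}" "p (Hat (?\<chi> \<psi>) zero_vec) = b"
      using flag_of_color by blast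
    have \<psi>M: "\<psi> \<in> flags M" and \<chi>M: "?\<chi> \<psi> \<in> flags M" using \<psi>(1) base_flag \<Phi>1 \<chi> by auto
    have \<chi>N: "Hat (?\<chi> \<psi>) zero_vec \<in> flags N" using \<chi>M by (simp add: Hat_in_N zero_in_vecs)
    have "mirror (?\<chi> \<psi>) = adj M 1 (adj M 0 \<psi>)"
      using mirror_adj[OF _ \<psi>M, of 1] mirror_edge[OF edges[OF \<psi>(1)]] n_ge_4 by simp
    moreover obtain \<phi> x where "foldr step v (Hat (?\<chi> \<psi>) zero_vec) = Hat \<phi> x"
      "\<phi> \<in> component M {2..<n - 1} (mirror (?\<chi> \<psi>))"
      using generic_walk[OF v \<chi>M] odd by auto
    ultimately have "edge_of (foldr step v (Hat (?\<chi> \<psi>) zero_vec)) = edge_of (adj M 1 (adj M 0 \<psi>))"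
      using edge_of_component[OF mirror_flag[OF \<chi>M]] by simp
    moreover have "foldr step v (Hat (?\<chi> \<psi>) zero_vec) = word N ?v0 (Hat (?\<chi> \<psi>) zero_vec)"
      using eq[OF \<chi>N \<psi>(2)] transfer[OF \<chi>N] by simp
    then have "edge_of (foldr step v (Hat (?\<chi> \<psi>) zero_vec)) = edge_of (adj M 1 \<psi>)"
      using edge_of_word[OF \<chi>N v0] by simp
    moreover have "2 \<le> n - 1" using n_ge_4 by simp
    ultimately show False
      using edge_of_neighbour_edges[of "n - 1" \<psi>] \<psi>M unfolding M_def by metis
  qed
  then show ?thesis using transfer word_remove_zeros v assms(4) by simp
qed

section \<open>The intersection property of the voltages\<close>

lemma voltage_intersection:
  assumes "1 < k" "k \<le> n" "m \<le> n"
  shows "path_voltage \<xi> ` paths (two_premaniplex n I) {0..m} a b \<inter>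
      path_voltage \<xi> ` paths (two_premaniplex n I) {k..n} a b =
    path_voltage \<xi> ` paths (two_premaniplex n I) {k..m} a b"
proof -
  let ?X = "two_premaniplex n I"
  have V: "path_voltage \<xi> ` paths ?X J a b =
      {walk_voltage \<xi> w | w. walk ?X a b w \<and> snd ` set w \<subseteq> J}" for J
  proof -
    have "col ?X = snd" by (simp add: two_premaniplex_def)
    moreover have "path_voltage \<xi> ` paths ?X J a b =
        {walk_voltage \<xi> w | w. walk ?X a b w \<and> col ?X ` set w \<subseteq> J}"
    proof (rule path_voltage_paths)
      fix d assume "d \<in> darts ?X"
      then show "\<xi> (rev_dart ?X d) \<circ>> \<xi> d = id" using xi_inverse by (cases d) simp
    qed
    ultimately show ?thesis by simp
  qed
  have main: "\<exists>w. walk ?X a b w \<and> snd ` set w \<subseteq> {k..m} \<and> walk_voltage \<xi> u = walk_voltage \<xi> w"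
    if u: "walk ?X a b u" "snd ` set u \<subseteq> {0..m}" and v: "walk ?X a b v" "snd ` set v \<subseteq> {k..n}"
      and eq: "walk_voltage \<xi> u = walk_voltage \<xi> v" for u v
  proof (cases "m = n")
    case True
    then show ?thesis using v eq by blast
  next
    case False
    let ?u = "map snd u" and ?v = "map snd v"
    let ?g = "filter (\<lambda>i. i \<noteq> n) ?v"
    have cu: "set ?u \<subseteq> {..<n}" "set ?u \<subseteq> {..m}" using u(2) assms False by auto
    have cv: "set ?v \<subseteq> {2..n}" "set ?g \<subseteq> {..<n} \<inter> {k..}" using v(2) assms by auto
    have "word N ?u \<Theta> = foldr step ?v \<Theta>" if "\<Theta> \<in> flags N" "p \<Theta> = b" for \<Theta>
      using walk_voltage_eqD[OF u(1) v(1) eq that] foldr_step_low[OF cu(1)] by simp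
    then have g: "word N ?u \<Theta> = word N ?g \<Theta>" if "\<Theta> \<in> flags N" for \<Theta>
      using rho_free_replacement[OF cu(1) cv(1) _ that] by blast
    obtain \<Theta> where \<Theta>: "\<Theta> \<in> flags N" "p \<Theta> = b"
    proof -
      obtain \<Theta> where "\<Theta> \<in> flags N" using N.flags_nonempty by blast
      moreover have "adj N 0 \<Theta> \<in> flags N" "p (adj N 0 \<Theta>) = other (p \<Theta>)"
        using \<open>\<Theta> \<in> flags N\<close> n_ge_4 by (simp_all add: N.adj_flag mrank_N p_adj)
      ultimately show thesis using that by (cases b; cases "p \<Theta>") auto
    qed
    have "set ?u \<subseteq> {..<mrank N} \<inter> {..m}" "set ?g \<subseteq> {..<mrank N} \<inter> {k..}"
      using cu cv(2) unfolding mrank_N by blast+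
    from N.intersection_property[OF \<Theta>(1) this g[OF \<Theta>(1)]]
    obtain h where h: "set h \<subseteq> {..<n} \<inter> {k..m}" "word N ?u \<Theta> = word N h \<Theta>"
      unfolding mrank_N by blast
    then have all: "word N ?u \<Theta>' = word N h \<Theta>'" if "\<Theta>' \<in> flags N" for \<Theta>'
      using N.word_eq_transfer[OF h(2) _ _ \<Theta>(1) that] cu(1) h(1) unfolding mrank_N by blast
    have hn: "set h \<subseteq> {..n}" "set h \<subseteq> {..<n}" using h(1) by auto
    have "foldr (neighbour I) h b = p (word N h \<Theta>)"
      using p_foldr_step[OF \<Theta>(1) hn(1)] foldr_step_low[OF hn(2)] \<Theta>(2) by simp
    also have "\<dots> = p (foldr step ?u \<Theta>)" using h(2) foldr_step_low[OF cu(1)] by simp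
    also have "\<dots> = a"
      using p_foldr_step[OF \<Theta>(1), of ?u] walk_colors[OF u(1)] walk_end[OF u(1)] \<Theta>(2) by simp
    finally have walk: "walk ?X a b (lift_word I a h)" using walk_lift_word hn(1) by blast
    have colors: "snd ` set (lift_word I a h) = set h"
      using colors_lift_word[of I a h] by (metis set_map)
    have "walk_voltage \<xi> u = walk_voltage \<xi> (lift_word I a h)"
    proof (rule walk_voltage_eqI[OF u(1) walk])
      show "n \<notin> snd ` set u" using cu(1) by auto
      show "n \<notin> snd ` set (lift_word I a h)" using hn(2) colors by auto
    qed (simp add: all colors_lift_word)
    moreover have "snd ` set (lift_word I a h) \<subseteq> {k..m}" unfolding colors using h(1) by simp
    ultimately show ?thesis using walk by blast
  qed
  have mono: "path_voltage \<xi> ` paths ?X J a b \<subseteq> path_voltage \<xi> ` paths ?X J' a b"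
    if "J \<subseteq> J'" for J J'
    using that unfolding V by blast
  show ?thesis
  proof (intro equalityI Int_greatest)
    show "path_voltage \<xi> ` paths ?X {k..m} a b \<subseteq> path_voltage \<xi> ` paths ?X {0..m} a b"
      "path_voltage \<xi> ` paths ?X {k..m} a b \<subseteq> path_voltage \<xi> ` paths ?X {k..n} a b"
      using assms by (intro mono; simp)+
    show "path_voltage \<xi> ` paths ?X {0..m} a b \<inter> path_voltage \<xi> ` paths ?X {k..n} a b
        \<subseteq> path_voltage \<xi> ` paths ?X {k..m} a b"
    proof
      fix g assume "g \<in> path_voltage \<xi> ` paths ?X {0..m} a b \<inter> path_voltage \<xi> ` paths ?X {k..n} a b"
      then obtain u v where "walk ?X a b u" "snd ` set u \<subseteq> {0..m}" "g = walk_voltage \<xi> u"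
        "walk ?X a b v" "snd ` set v \<subseteq> {k..n}" "g = walk_voltage \<xi> v"
        unfolding V Int_iff mem_Collect_eq by (elim conjE exE)
      with main[of u v] show "g \<in> path_voltage \<xi> ` paths ?X {k..m} a b"
        unfolding V mem_Collect_eq by metis
    qed
  qed
qed

end

theorem corollary6p5:
  fixes n k m l :: nat
    and I :: "nat set"
    and S3 :: "flag set set"
    and \<Phi>0 :: flag
    and p :: "flag \<Rightarrow> vertex"
    and \<rho> :: "flag \<Rightarrow> flag"
    and s :: "flag \<times> nat \<Rightarrow> flag \<times> nat"
    and a b :: vertex
  defines "X \<equiv> two_premaniplex n I"
    and "\<xi> \<equiv> xi n I p l \<rho> s"
  assumes "n \<ge> 4"
    and "I \<subseteq> {0..n}" and "0 \<notin> I" and "n \<notin> I"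
    and "admissible_S3 S3"
    and "\<Phi>0 \<in> flags (MM (n - 1))"
    and "is_rho0 n S3 (face_at (MM (n - 1)) 1 \<Phi>0) \<rho>"
    and "covering (MM n) (delete_color n X) p"
    and "l > 0"
    and "s permutes white_points n p l" and "s \<circ>> s = id"
    and "\<And>\<Psi> c. fst (s (\<Psi>, c)) = \<Psi>"
    and "s \<circ>> white_action n p l (\<rho> \<circ>> adj (MM n) 0) = white_action n p l (\<rho> \<circ>> adj (MM n) 0) \<circ>> s"
    and "1 < k" and "k \<le> n" and "m \<le> n"
  shows "path_voltage \<xi> ` paths X {0..m} a b \<inter> path_voltage \<xi> ` paths X {k..n} a b
           = path_voltage \<xi> ` paths X {k..m} a b"
proof -
  interpret voltage_setting n S3 \<Phi>0 \<rho> "MM (n - 1)" "MM n" I p l s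
    by unfold_locales (use assms in auto)
  show ?thesis unfolding X_def \<xi>_def using assms by (intro voltage_intersection) auto
qed

end
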